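(* Let $G$ be a loopless graph (a finite connected multigraph without loops), let $\Gamma$ be the metric graph corresponding to $G$, i.e. the metric graph obtained from $G$ by setting the length of each edge to be equal to one, and let $D$ be a divisor on $G$ (also regarded as a divisor on $\Gamma$ supported on the vertices). Then $$r_G(D)=r_\Gamma(D).$$
   Context: Graphs. A graph $G$ is a finite connected multigraph (parallel edges allowed). A divisor on $G$ is an element $D=\sum_{v\in V(G)}D(v)(v)$, $D(v)\in\mathbb Z$, of the free abelian group $\mathrm{Div}(G)$ on $V(G)$; it is effective ($D\ge 0$) if $D(v)\ge 0$ for all $v$; its degree is $\deg(D)=\sum_v D(v)$. For $f:V(G)\to\mathbb Z$ let $\mathrm{div}(f)=\sum_{v\in V(G)}\sum_{e=vw\in E(G)}(f(v)-f(w))(v)$. Divisors $D,D'$ on $G$ are equivalent, $D\sim_G D'$, if $D-D'=\mathrm{div}(f)$ for some $f:V(G)\to\mathbb Z$. Put $|D|_G=\{E\in \mathrm{Div}(G): E\ge 0,\ E\sim_G D\}$ and $$r_G(D)=\min\{\deg(E): E\in\mathrm{Div}(G),\ E\ge 0,\ |D-E|_G=\emptyset\}-1 .$$ Metric graphs. A metric graph $\Gamma$ is a finite connected multigraph in which each edge is assigned a positive (finite) real length; each edge is identified with a closed interval of that length, with the end points of the interval identified with the end vertices of the edge. The points of $\Gamma$ are all points of these intervals. $\mathrm{Div}(\Gamma)$ is the free abelian group on the (infinite) set of points of $\Gamma$; a divisor $D=\sum_{v\in\Gamma}D(v)(v)\in\mathrm{Div}(\Gamma)$ (with $D(v)\in\mathbb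 Z$ nonzero for only finitely many points $v$) is effective ($D\ge 0$) if $D(v)\ge 0$ for all points $v$ of $\Gamma$, and its degree is $\deg(D)=\sum_{v\in\Gamma}D(v)$. A rational function on $\Gamma$ is a continuous function $f:\Gamma\to\mathbb R$ which is piecewise linear with finitely many pieces and integer slopes on every edge. For a point $v$, $\mathrm{ord}_v(f)$ is the sum of the outgoing slopes of $f$ over all segments emanating from $v$, and $\mathrm{div}(f)=\sum_v \mathrm{ord}_v(f)(v)$. Divisors $D,D'$ on $\Gamma$ are equivalent, $D\sim_\Gamma D'$, if $D=D'+\mathrm{div}(f)$ for some rational function $f$ on $\Gamma$. Put $|D|_\Gamma=\{E\in\mathrm{Div}(\Gamma):E\ge 0,\ E\sim_\Gamma D\}$ and $$r_\Gamma(D)=\min\{\deg(E): E\in\mathrm{Div}(\Gamma),\ E\ge 0,\ |D-E|_\Gamma=\emptyset\}-1 .$$ *)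

theory Defs
  imports "HOL-Analysis.Analysis" "HOL-Library.Poly_Mapping" "Graph_Theory.Graph_Theory"
begin

text \<open>
  A multigraph is a \<open>pre_digraph\<close> in which every arc stands for exactly one
  undirected edge; the choice of tail and head is an arbitrary reference orientation, and parallel arcs
  (in either direction) are parallel edges.  \<open>Div\<close> of a set of points is the free abelian group on it,
  i.e. the finitely supported integer-valued functions with support in that set.
\<close>

section \<open>Divisors\<close>

type_synonym 'p divisor = "'p \<Rightarrow>\<^sub>0 int"

definition divisors :: "'p set \<Rightarrow> 'p divisor set" where
  "divisors P = {D. Poly_Mapping.keys D \<subseteq> P}"

definition effective :: "'p divisor \<Rightarrow> bool" where
  "effective D \<longleftrightarrow> (\<forall>p. 0 \<le> Poly_Mapping.lookup D p)"

definition deg :: "'p divisor \<Rightarrow> int" where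
  "deg D = (\<Sum>p\<in>Poly_Mapping.keys D. Poly_Mapping.lookup D p)"

text \<open>
  The linear system \<open>|D|\<close> and the rank, relative to a set \<open>P\<close> of points and an equivalence \<open>R\<close> of
  divisors.  On a nonempty \<open>P\<close>, and if \<open>R\<close> preserves degrees, the minimum below is attained: degrees of
  effective divisors are nonnegative, and every effective \<open>E\<close> with \<open>deg E > deg D\<close> qualifies.
\<close>

definition linear_system ::
    "'p set \<Rightarrow> ('p divisor \<Rightarrow> 'p divisor \<Rightarrow> bool) \<Rightarrow> 'p divisor \<Rightarrow> 'p divisor set" where
  "linear_system P R D = {E \<in> divisors P. effective E \<and> R E D}"

definition divisor_rank ::
    "'p set \<Rightarrow> ('p divisor \<Rightarrow> 'p divisor \<Rightarrow> bool) \<Rightarrow> 'p divisor \<Rightarrow> int" where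
  "divisor_rank P R D =
     (LEAST k. \<exists>E\<in>divisors P. effective E \<and> linear_system P R (D - E) = {} \<and> k = deg E) - 1"

section \<open>Graphs\<close>

definition graph_div :: "('a, 'b) pre_digraph \<Rightarrow> ('a \<Rightarrow> int) \<Rightarrow> 'a divisor" where
  "graph_div G f = (\<Sum>v\<in>verts G. frag_cmul
     ((\<Sum>e | e \<in> arcs G \<and> tail G e = v. f v - f (head G e)) +
      (\<Sum>e | e \<in> arcs G \<and> head G e = v. f v - f (tail G e))) (frag_of v))"

definition graph_equiv :: "('a, 'b) pre_digraph \<Rightarrow> 'a divisor \<Rightarrow> 'a divisor \<Rightarrow> bool" where
  "graph_equiv G D D' \<longleftrightarrow> (\<exists>f. D - D' = graph_div G f)"

definition graph_rank :: "('a, 'b) pre_digraph \<Rightarrow> 'a divisor \<Rightarrow> int" where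
  "graph_rank G = divisor_rank (verts G) (graph_equiv G)"

section \<open>Metric graphs\<close>

text \<open>
  A metric graph is given by a finite connected multigraph \<open>G\<close> and positive edge lengths \<open>l\<close>.  Its points
  are the vertices and the points \<open>Inner e t\<close> with \<open>0 < t < l e\<close>, at distance \<open>t\<close> from the tail of \<open>e\<close>;
  \<open>edge_point G l e\<close> is the quotient map from the closed interval \<open>{0..l e}\<close> of the edge.  Outside
  that interval its values are not points of the metric graph.
\<close>

datatype ('a, 'b) mpoint = Vertex 'a | Inner 'b real

definition edge_point ::
    "('a, 'b) pre_digraph \<Rightarrow> ('b \<Rightarrow> real) \<Rightarrow> 'b \<Rightarrow> real \<Rightarrow> ('a, 'b) mpoint" where
  "edge_point G l e t =
     (if t = 0 then Vertex (tail G e) else if t = l e then Vertex (head G e) else Inner e t)"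

definition mpoints :: "('a, 'b) pre_digraph \<Rightarrow> ('b \<Rightarrow> real) \<Rightarrow> ('a, 'b) mpoint set" where
  "mpoints G l = Vertex ` verts G \<union> {Inner e t | e t. e \<in> arcs G \<and> 0 < t \<and> t < l e}"

text \<open>The quotient topology of the disjoint union of the edges (and of the vertices).\<close>

definition mtopology_open ::
    "('a, 'b) pre_digraph \<Rightarrow> ('b \<Rightarrow> real) \<Rightarrow> ('a, 'b) mpoint set \<Rightarrow> bool" where
  "mtopology_open G l U \<longleftrightarrow> U \<subseteq> mpoints G l \<and>
     (\<forall>e\<in>arcs G. openin (top_of_set {0..l e}) {t \<in> {0..l e}. edge_point G l e t \<in> U})"

definition graph_topology ::
    "('a, 'b) pre_digraph \<Rightarrow> ('b \<Rightarrow> real) \<Rightarrow> ('a, 'b) mpoint topology" where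
  "graph_topology G l = topology (mtopology_open G l)"

lemma openin_graph_topology: "openin (graph_topology G l) = mtopology_open G l"
proof -
  have "istopology (mtopology_open G l)"
    unfolding istopology_def
  proof (intro conjI allI impI)
    fix S T assume S: "mtopology_open G l S" and T: "mtopology_open G l T"
    have *: "{t \<in> {0..l e}. edge_point G l e t \<in> S \<inter> T} =
        {t \<in> {0..l e}. edge_point G l e t \<in> S} \<inter> {t \<in> {0..l e}. edge_point G l e t \<in> T}" for e
      by blast
    show "mtopology_open G l (S \<inter> T)"
      using S T unfolding mtopology_open_def * by (blast intro: openin_Int)
  next
    fix K assume K: "\<forall>S\<in>K. mtopology_open G l S"
    have *: "{t \<in> {0..l e}. edge_point G l e t \<in> \<Union>K} =
        (\<Union>S\<in>K. {t \<in> {0..l e}. edge_point G l e t \<in> S})" for e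
      by blast
    show "mtopology_open G l (\<Union>K)"
      using K unfolding mtopology_open_def * by (blast intro: openin_Union)
  qed
  then show ?thesis
    by (simp add: graph_topology_def topology_inverse')
qed

lemma topspace_graph_topology:
  assumes "wf_digraph G" and "\<And>e. e \<in> arcs G \<Longrightarrow> l e > 0"
  shows "topspace (graph_topology G l) = mpoints G l"
proof -
  have "{t \<in> {0..l e}. edge_point G l e t \<in> mpoints G l} = {0..l e}" if "e \<in> arcs G" for e
    using that assms by (auto simp: edge_point_def mpoints_def wf_digraph_def)
  then have "mtopology_open G l (mpoints G l)"
    by (simp add: mtopology_open_def)
  then show ?thesis
    unfolding topspace_def openin_graph_topology by (auto simp: mtopology_open_def)
qed

definition piecewise_linear_int :: "real \<Rightarrow> (real \<Rightarrow> real) \<Rightarrow> bool" where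
  "piecewise_linear_int L g \<longleftrightarrow> (\<exists>(n::nat) x. x 0 = 0 \<and> x n = L \<and>
     (\<forall>i<n. x i < x (Suc i) \<and>
        (\<exists>(m::int) c. \<forall>t\<in>{x i..x (Suc i)}. g t = of_int m * t + c)))"

definition rational_function ::
    "('a, 'b) pre_digraph \<Rightarrow> ('b \<Rightarrow> real) \<Rightarrow> (('a, 'b) mpoint \<Rightarrow> real) \<Rightarrow> bool" where
  "rational_function G l f \<longleftrightarrow> continuous_map (graph_topology G l) euclideanreal f \<and>
     (\<forall>e\<in>arcs G. piecewise_linear_int (l e) (f \<circ> edge_point G l e))"

text \<open>
  The segments emanating from \<open>p\<close>: triples \<open>(e, t, d)\<close> such that \<open>p\<close> is the point of \<open>e\<close> with coordinate
  \<open>t\<close>, and \<open>d\<close> is a direction (\<open>1\<close> towards the head, \<open>-1\<close> towards the tail) in which \<open>e\<close> continues.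
  A loop contributes two segments at its vertex.
\<close>

definition segments ::
    "('a, 'b) pre_digraph \<Rightarrow> ('b \<Rightarrow> real) \<Rightarrow> ('a, 'b) mpoint \<Rightarrow> ('b \<times> real \<times> real) set" where
  "segments G l p = {(e, t, d). e \<in> arcs G \<and> t \<in> {0..l e} \<and> edge_point G l e t = p \<and>
     (d = 1 \<and> t < l e \<or> d = -1 \<and> 0 < t)}"

definition slope :: "(real \<Rightarrow> real) \<Rightarrow> real \<Rightarrow> real \<Rightarrow> int" where
  "slope g t d = (THE n. \<exists>\<epsilon>>0. \<forall>h\<in>{0..\<epsilon>}. g (t + d * h) = g t + of_int n * h)"

lemma slope_eqI:
  assumes "\<epsilon> > 0" and n: "\<And>h. 0 \<le> h \<Longrightarrow> h \<le> \<epsilon> \<Longrightarrow> g (t + d * h) = g t + of_int n * h"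
  shows "slope g t d = n"
  unfolding slope_def
proof (rule the_equality)
  show "\<exists>\<epsilon>>0. \<forall>h\<in>{0..\<epsilon>}. g (t + d * h) = g t + of_int n * h"
    using assms by auto
next
  fix m :: int assume "\<exists>\<epsilon>>0. \<forall>h\<in>{0..\<epsilon>}. g (t + d * h) = g t + of_int m * h"
  then obtain \<delta> where \<delta>: "\<delta> > 0" "\<And>h. 0 \<le> h \<Longrightarrow> h \<le> \<delta> \<Longrightarrow> g (t + d * h) = g t + of_int m * h"
    by auto
  have "real_of_int m * min \<epsilon> \<delta> = of_int n * min \<epsilon> \<delta>"
    using n[of "min \<epsilon> \<delta>"] \<delta>(2)[of "min \<epsilon> \<delta>"] \<open>\<epsilon> > 0\<close> \<open>\<delta> > 0\<close> by simp
  moreover have "min \<epsilon> \<delta> > 0"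
    using \<open>\<epsilon> > 0\<close> \<open>\<delta> > 0\<close> by simp
  ultimately show "m = n"
    by simp
qed

definition ord_at ::
    "('a, 'b) pre_digraph \<Rightarrow> ('b \<Rightarrow> real) \<Rightarrow> (('a, 'b) mpoint \<Rightarrow> real) \<Rightarrow> ('a, 'b) mpoint \<Rightarrow> int" where
  "ord_at G l f p = (\<Sum>(e, t, d)\<in>segments G l p. slope (f \<circ> edge_point G l e) t d)"

definition metric_div ::
    "('a, 'b) pre_digraph \<Rightarrow> ('b \<Rightarrow> real) \<Rightarrow> (('a, 'b) mpoint \<Rightarrow> real) \<Rightarrow> ('a, 'b) mpoint divisor" where
  "metric_div G l f =
     (\<Sum>p | p \<in> mpoints G l \<and> ord_at G l f p \<noteq> 0. frag_cmul (ord_at G l f p) (frag_of p))"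

definition metric_equiv ::
    "('a, 'b) pre_digraph \<Rightarrow> ('b \<Rightarrow> real) \<Rightarrow> ('a, 'b) mpoint divisor \<Rightarrow> ('a, 'b) mpoint divisor \<Rightarrow> bool"
  where "metric_equiv G l D D' \<longleftrightarrow> (\<exists>f. rational_function G l f \<and> D = D' + metric_div G l f)"

definition metric_rank ::
    "('a, 'b) pre_digraph \<Rightarrow> ('b \<Rightarrow> real) \<Rightarrow> ('a, 'b) mpoint divisor \<Rightarrow> int" where
  "metric_rank G l = divisor_rank (mpoints G l) (metric_equiv G l)"

definition vertex_divisor :: "'a divisor \<Rightarrow> ('a, 'b) mpoint divisor" where
  "vertex_divisor D = frag_extend (\<lambda>v. frag_of (Vertex v)) D"

end

theory Submission
  imports Defs
begin

text \<open>
  Both ranks are minima over degrees of obstructing effective divisors, and the two sets of degrees agree.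

  If \<open>D + div f \<ge> 0\<close> on the metric graph with \<open>D\<close> supported on vertices, then \<open>f\<close> is convex along
  every edge, so outgoing slopes at \<open>v\<close> along \<open>vw\<close> are integers below \<open>f(w) - f(v)\<close>, hence below
  \<open>\<lfloor>f(w)\<rfloor> - \<lfloor>f(v)\<rfloor>\<close>: rounding \<open>f\<close> down at the vertices solves the problem on the graph.
  Conversely, linear interpolation turns graph functions into rational functions.

  An obstructing divisor can be moved to the vertices one chip at a time: if \<open>D\<close> is equivalent to
  effective divisors containing either end of an edge, then also to one containing any given inner point
  of the edge.  Cutting off the rational function between the two at its value at that point
  produces an effective divisor with chips on both sides of the point, which can be moved together.
\<close>

section \<open>One-sided slopes\<close>

text \<open>\<open>slope\<close> is a definite description; this relation also carries existence.
  The filter lets sums and truncations be handled without choosing radii, and omitting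
  \<open>h = 0\<close> loses nothing since the equation is trivial there.\<close>

definition has_slope :: "(real \<Rightarrow> real) \<Rightarrow> real \<Rightarrow> real \<Rightarrow> int \<Rightarrow> bool" where
  "has_slope g t d n \<longleftrightarrow> (\<forall>\<^sub>F h in at_right 0. g (t + d * h) = g t + of_int n * h)"

lemma has_slopeI:
  assumes "\<epsilon> > 0" and "\<And>h. 0 < h \<Longrightarrow> h < \<epsilon> \<Longrightarrow> g (t + d * h) = g t + of_int n * h"
  shows "has_slope g t d n"
  unfolding has_slope_def eventually_at_right_field using assms by auto

lemma has_slopeE:
  assumes "has_slope g t d n"
  obtains \<epsilon> where "\<epsilon> > 0" and "\<And>h. 0 \<le> h \<Longrightarrow> h < \<epsilon> \<Longrightarrow> g (t + d * h) = g t + of_int n * h"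
proof -
  obtain \<epsilon> where \<epsilon>: "\<epsilon> > 0" "\<And>h. 0 < h \<Longrightarrow> h < \<epsilon> \<Longrightarrow> g (t + d * h) = g t + of_int n * h"
    using assms unfolding has_slope_def eventually_at_right_field by auto
  have "g (t + d * h) = g t + of_int n * h" if "0 \<le> h" "h < \<epsilon>" for h
    using \<epsilon>(2)[of h] that by (cases "h = 0") auto
  then show thesis using that \<epsilon>(1) by blast
qed

lemma slope_eq:
  assumes "has_slope g t d n"
  shows "slope g t d = n"
proof -
  obtain \<epsilon> where \<epsilon>: "\<epsilon> > 0" "\<And>h. 0 \<le> h \<Longrightarrow> h < \<epsilon> \<Longrightarrow> g (t + d * h) = g t + of_int n * h"
    using has_slopeE[OF assms] by blast
  show ?thesis
    by (rule slope_eqI[of "\<epsilon> / 2"]) (use \<epsilon> in auto)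
qed

lemma has_slope_add:
  assumes "has_slope f t d m" and "has_slope g t d n"
  shows "has_slope (\<lambda>u. f u + g u) t d (m + n)"
  using assms unfolding has_slope_def by eventually_elim (simp add: algebra_simps)

lemma has_slope_uminus:
  assumes "has_slope f t d m"
  shows "has_slope (\<lambda>u. - f u) t d (- m)"
  using assms unfolding has_slope_def by eventually_elim simp

text \<open>Where \<open>g t\<close> differs from \<open>c\<close>, continuity keeps
  \<open>g\<close> on the same side of \<open>c\<close> for small steps. At equality only a rising
  direction stays above the cut, so the slope becomes its positive part.\<close>

lemma has_slope_max:
  assumes "has_slope g t d n"
  shows "has_slope (\<lambda>u. max (g u) c) t d (if c < g t then n else if g t = c then max n 0 else 0)"
proof -
  have ev: "\<forall>\<^sub>F h in at_right 0. g (t + d * h) = g t + of_int n * h"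
    using assms unfolding has_slope_def .
  have lim: "((\<lambda>h. g t + of_int n * h) \<longlongrightarrow> g t + of_int n * 0) (at_right 0)"
    by (intro tendsto_intros)
  have pos: "\<forall>\<^sub>F h in at_right (0::real). 0 < h"
    by (simp add: eventually_at_right_less)
  consider "c < g t" | "g t = c" | "g t < c" by linarith
  then show ?thesis
  proof cases
    case 1
    then have "\<forall>\<^sub>F h in at_right 0. c < g t + of_int n * h"
      using order_tendstoD(1)[OF lim] by simp
    with ev show ?thesis unfolding has_slope_def by eventually_elim (use 1 in auto)
  next
    case 2
    show ?thesis
    proof (cases "0 \<le> n")
      case True
      from ev pos show ?thesis unfolding has_slope_def
      proof eventually_elim
        case (elim h)
        then have "0 \<le> of_int n * h" using True by simp
        then show ?case using elim True 2 by simp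
      qed
    next
      case False
      from ev pos have "\<forall>\<^sub>F h in at_right 0. max (g (t + d * h)) c = c"
      proof eventually_elim
        case (elim h)
        then have "of_int n * h < 0" using False by (simp add: mult_neg_pos)
        then show ?case using elim 2 by simp
      qed
      then show ?thesis unfolding has_slope_def
        by eventually_elim (use False 2 in auto)
    qed
  next
    case 3
    then have "\<forall>\<^sub>F h in at_right 0. g t + of_int n * h < c"
      using order_tendstoD(2)[OF lim] by simp
    with ev show ?thesis unfolding has_slope_def by eventually_elim (use 3 in auto)
  qed
qed

section \<open>Directions inside an interval and local linearity\<close>

definition inward :: "real \<Rightarrow> real \<Rightarrow> real \<Rightarrow> bool" where
  "inward L t d \<longleftrightarrow> 0 \<le> t \<and> t \<le> L \<and> (d = 1 \<and> t < L \<or> d = -1 \<and> 0 < t)"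

lemma eventually_inward:
  assumes "inward L t d"
  shows "\<forall>\<^sub>F h in at_right 0. t + d * h \<in> {0..L}"
  unfolding eventually_at_right_field
  by (rule exI[of _ "if d = 1 then L - t else t"]) (use assms in \<open>auto simp: inward_def\<close>)

text \<open>Small steps in an inward direction stay in the interval, so values of
  \<open>edge_point\<close> beyond it, which are not points of the graph, never matter.\<close>

lemma has_slope_cong:
  assumes "inward L t d" and "\<And>u. u \<in> {0..L} \<Longrightarrow> f u = g u"
  shows "has_slope f t d n \<longleftrightarrow> has_slope g t d n"
proof -
  have "f t = g t"
    using assms by (simp add: inward_def)
  then show ?thesis
    unfolding has_slope_def
    by (intro eventually_cong eventually_mono[OF eventually_inward[OF assms(1)]])
      (use assms(2) in auto)
qed

text \<open>A pointwise substitute for \<open>piecewise_linear_int\<close>: it passes to sums and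
  maxima without a common refinement of subdivisions. Compactness makes the two notions equivalent
  for \<open>0 \<le> L\<close>.\<close>

definition locally_linear :: "real \<Rightarrow> (real \<Rightarrow> real) \<Rightarrow> bool" where
  "locally_linear L g \<longleftrightarrow> (\<forall>t d. inward L t d \<longrightarrow> (\<exists>n. has_slope g t d n))"

lemma locally_linear_slope:
  assumes "locally_linear L g" and "inward L t d"
  shows "has_slope g t d (slope g t d)"
  using assms slope_eq unfolding locally_linear_def by blast

lemma locally_linear_nbhd:
  assumes "locally_linear L g" and "t \<in> {0..L}"
  obtains \<delta> where "\<delta> > 0"
    and "\<And>u. u \<in> {0..L} \<Longrightarrow> t \<le> u \<Longrightarrow> u < t + \<delta> \<Longrightarrow> g u = g t + of_int (slope g t 1) * (u - t)"
    and "\<And>u. u \<in> {0..L} \<Longrightarrow> u \<le> t \<Longrightarrow> t - \<delta> < u \<Longrightarrow> g u = g t + of_int (slope g t (-1)) * (t - u)"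
proof -
  have "\<exists>\<delta>>0. \<forall>u\<in>{0..L}. t \<le> u \<and> u < t + \<delta> \<longrightarrow> g u = g t + of_int (slope g t 1) * (u - t)"
  \<comment> \<open>If \<open>t = L\<close>, the only admissible \<open>u\<close> is
    \<open>t\<close> itself, and the arbitrary value of \<open>slope g t 1\<close> is multiplied by
    zero.\<close>
  proof (cases "t < L")
    case True
    then have "has_slope g t 1 (slope g t 1)"
      using assms by (intro locally_linear_slope) (auto simp: inward_def)
    then obtain \<epsilon> where \<epsilon>: "\<epsilon> > 0"
      "\<And>h. 0 \<le> h \<Longrightarrow> h < \<epsilon> \<Longrightarrow> g (t + 1 * h) = g t + of_int (slope g t 1) * h"
      using has_slopeE by blast
    have "g u = g t + of_int (slope g t 1) * (u - t)" if "t \<le> u" "u < t + \<epsilon>" for u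
      using \<epsilon>(2)[of "u - t"] that by simp
    then show ?thesis
      using \<epsilon>(1) by blast
  qed (use assms in \<open>auto intro!: exI[of _ 1]\<close>)
  then obtain \<delta>1 where 1: "\<delta>1 > 0"
    "\<And>u. u \<in> {0..L} \<Longrightarrow> t \<le> u \<Longrightarrow> u < t + \<delta>1 \<Longrightarrow> g u = g t + of_int (slope g t 1) * (u - t)"
    by blast
  have "\<exists>\<delta>>0. \<forall>u\<in>{0..L}. u \<le> t \<and> t - \<delta> < u \<longrightarrow> g u = g t + of_int (slope g t (-1)) * (t - u)"
  proof (cases "0 < t")
    case True
    then have "has_slope g t (-1) (slope g t (-1))"
      using assms by (intro locally_linear_slope) (auto simp: inward_def)
    then obtain \<epsilon> where \<epsilon>: "\<epsilon> > 0"
      "\<And>h. 0 \<le> h \<Longrightarrow> h < \<epsilon> \<Longrightarrow> g (t + -1 * h) = g t + of_int (slope g t (-1)) * h"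
      using has_slopeE by blast
    have "g u = g t + of_int (slope g t (-1)) * (t - u)" if "u \<le> t" "t - \<epsilon> < u" for u
      using \<epsilon>(2)[of "t - u"] that by simp
    then show ?thesis
      using \<epsilon>(1) by blast
  qed (use assms in \<open>auto intro!: exI[of _ 1]\<close>)
  then obtain \<delta>2 where 2: "\<delta>2 > 0"
    "\<And>u. u \<in> {0..L} \<Longrightarrow> u \<le> t \<Longrightarrow> t - \<delta>2 < u \<Longrightarrow> g u = g t + of_int (slope g t (-1)) * (t - u)"
    by blast
  show thesis
  proof (rule that[of "min \<delta>1 \<delta>2"])
    show "0 < min \<delta>1 \<delta>2" using 1(1) 2(1) by simp
  next
    fix u assume "u \<in> {0..L}" "t \<le> u" "u < t + min \<delta>1 \<delta>2"
    then show "g u = g t + of_int (slope g t 1) * (u - t)" by (intro 1(2)) auto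
  next
    fix u assume "u \<in> {0..L}" "u \<le> t" "t - min \<delta>1 \<delta>2 < u"
    then show "g u = g t + of_int (slope g t (-1)) * (t - u)" by (intro 2(2)) auto
  qed
qed

lemma continuous_on_locally_linear:
  assumes "locally_linear L g"
  shows "continuous_on {0..L} g"
  unfolding continuous_on_iff
proof (intro ballI allI impI)
  fix t e :: real
  assume t: "t \<in> {0..L}" and "e > 0"
  obtain \<delta> where \<delta>: "\<delta> > 0"
    "\<And>u. u \<in> {0..L} \<Longrightarrow> t \<le> u \<Longrightarrow> u < t + \<delta> \<Longrightarrow> g u = g t + of_int (slope g t 1) * (u - t)"
    "\<And>u. u \<in> {0..L} \<Longrightarrow> u \<le> t \<Longrightarrow> t - \<delta> < u \<Longrightarrow> g u = g t + of_int (slope g t (-1)) * (t - u)"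
    using locally_linear_nbhd[OF assms t] by blast
  \<comment> \<open>A Lipschitz constant near \<open>t\<close>; the summand 1 keeps it positive when
    both slopes vanish.\<close>
  define K where "K = 1 + \<bar>real_of_int (slope g t 1)\<bar> + \<bar>real_of_int (slope g t (-1))\<bar>"
  have K: "K > 0" by (simp add: K_def add_pos_nonneg)
  have "dist (g u) (g t) < e" if u: "u \<in> {0..L}" "dist u t < min \<delta> (e / K)" for u
  proof -
    have "\<bar>g u - g t\<bar> \<le> K * \<bar>u - t\<bar>"
    proof (cases "t \<le> u")
      case True
      then have "\<bar>g u - g t\<bar> = \<bar>real_of_int (slope g t 1)\<bar> * \<bar>u - t\<bar>"
        using \<delta>(2)[of u] u by (simp add: dist_real_def abs_mult)
      also have "\<dots> \<le> K * \<bar>u - t\<bar>"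
        by (intro mult_right_mono) (auto simp: K_def)
      finally show ?thesis .
    next
      case False
      then have "\<bar>g u - g t\<bar> = \<bar>real_of_int (slope g t (-1))\<bar> * \<bar>u - t\<bar>"
        using \<delta>(3)[of u] u by (simp add: dist_real_def abs_mult)
      also have "\<dots> \<le> K * \<bar>u - t\<bar>"
        by (intro mult_right_mono) (auto simp: K_def)
      finally show ?thesis .
    qed
    also have "\<dots> < e"
      using u K by (simp add: dist_real_def field_simps)
    finally show ?thesis by (simp add: dist_real_def)
  qed
  then show "\<exists>d>0. \<forall>x'\<in>{0..L}. dist x' t < d \<longrightarrow> dist (g x') (g t) < e"
    using \<delta>(1) K \<open>e > 0\<close> by (intro exI[of _ "min \<delta> (e / K)"]) auto
qed

section \<open>Piecewise linear functions\<close>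

lemma linear_has_slope:
  fixes m :: int
  assumes "\<And>u. u \<in> {p..q} \<Longrightarrow> g u = of_int m * u + c"
  shows "p \<le> t \<Longrightarrow> t < q \<Longrightarrow> has_slope g t 1 m"
    and "p < t \<Longrightarrow> t \<le> q \<Longrightarrow> has_slope g t (-1) (- m)"
proof -
  assume "p \<le> t" "t < q"
  then show "has_slope g t 1 m"
    by (intro has_slopeI[of "q - t"]) (auto simp: assms algebra_simps)
next
  assume "p < t" "t \<le> q"
  then show "has_slope g t (-1) (- m)"
    by (intro has_slopeI[of "t - p"]) (auto simp: assms algebra_simps)
qed

lemma subdivision_cell_right:
  fixes x :: "nat \<Rightarrow> real"
  shows "x 0 \<le> t \<Longrightarrow> t < x n \<Longrightarrow> \<exists>i<n. x i \<le> t \<and> t < x (Suc i)"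
proof (induction n)
  case (Suc n)
  then show ?case by (cases "t < x n") (auto intro: less_SucI)
qed simp

lemma subdivision_cell_left:
  fixes x :: "nat \<Rightarrow> real"
  shows "x 0 < t \<Longrightarrow> t \<le> x n \<Longrightarrow> \<exists>i<n. x i < t \<and> t \<le> x (Suc i)"
proof (induction n)
  case (Suc n)
  then show ?case by (cases "t \<le> x n") (auto intro: less_SucI)
qed simp

lemma piecewise_linear_int_locally_linear:
  assumes "piecewise_linear_int L g"
  shows "locally_linear L g"
proof -
  obtain n x where x: "x 0 = 0" "x n = L"
    and lin: "\<And>i. i < n \<Longrightarrow> \<exists>(m::int) c. \<forall>t\<in>{x i..x (Suc i)}. g t = of_int m * t + c"
    using assms unfolding piecewise_linear_int_def by blast
  have "\<exists>m. has_slope g t d m" if in_dir: "inward L t d" for t d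
  proof (cases "d = 1")
    case True
    then obtain i where "i < n" "x i \<le> t" "t < x (Suc i)"
      using subdivision_cell_right[of x t n] x in_dir by (auto simp: inward_def)
    then show ?thesis
      using True linear_has_slope(1)[of "x i" "x (Suc i)" g _ _ t] lin by blast
  next
    case False
    then obtain i where "i < n" "x i < t" "t \<le> x (Suc i)" and "d = -1"
      using subdivision_cell_left[of x t n] x in_dir by (auto simp: inward_def)
    then show ?thesis
      using linear_has_slope(2)[of "x i" "x (Suc i)" g _ _ t] lin by blast
  qed
  then show ?thesis
    unfolding locally_linear_def by blast
qed

text \<open>Built cell by cell, so that concatenation is the plain induction
  \<open>subdivided_trans\<close>; \<open>subdivided_imp_sequence\<close> recovers the indexed form
  once at the end.\<close>

inductive subdivided :: "(real \<Rightarrow> real) \<Rightarrow> real \<Rightarrow> real \<Rightarrow> bool" for g where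
  subdivided_refl: "subdivided g a a"
| subdivided_step: "subdivided g a b \<Longrightarrow> b < c \<Longrightarrow> \<forall>t\<in>{b..c}. g t = of_int (m::int) * t + k \<Longrightarrow>
    subdivided g a c"

lemma subdivided_trans: "subdivided g b c \<Longrightarrow> subdivided g a b \<Longrightarrow> subdivided g a c"
  by (induction rule: subdivided.induct) (auto intro: subdivided.intros)

lemma subdivided_cell:
  assumes "a \<le> b" and "\<And>t. t \<in> {a..b} \<Longrightarrow> g t = of_int (m::int) * t + k"
  shows "subdivided g a b"
  using assms subdivided_step[OF subdivided_refl, of a b g m k] subdivided_refl[of g a]
  by (cases "a = b") auto

lemma subdivided_imp_sequence:
  assumes "subdivided g a b"
  shows "\<exists>(n::nat) x. x 0 = a \<and> x n = b \<and>
     (\<forall>i<n. x i < x (Suc i) \<and> (\<exists>(m::int) c. \<forall>t\<in>{x i..x (Suc i)}. g t = of_int m * t + c))"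
  using assms
proof induction
  case (subdivided_refl a)
  show ?case by (rule exI[of _ 0]) auto
next
  case (subdivided_step a b c m k)
  then obtain n :: nat and x where x: "x 0 = a" "x n = b"
    "\<forall>i<n. x i < x (Suc i) \<and> (\<exists>(m::int) c. \<forall>t\<in>{x i..x (Suc i)}. g t = of_int m * t + c)"
    by blast
  show ?case
    using x subdivided_step.hyps
    by (intro exI[of _ "Suc n"] exI[of _ "x(Suc n := c)"]) (auto simp: less_Suc_eq)
qed

text \<open>Compactness of \<open>{0..L}\<close> in the form of \<open>Bolzano\<close>: a short
  interval around \<open>t\<close> splits at \<open>t\<close> into at most two cells, and
  subdivisions concatenate.\<close>

lemma locally_linear_piecewise_linear_int:
  assumes "locally_linear L g" and "0 \<le> L"
  shows "piecewise_linear_int L g"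
proof -
  \<comment> \<open>\<open>Bolzano\<close> also asks about short intervals that stick out of
    \<open>{0..L}\<close>; the guard makes \<open>P\<close> true for them.\<close>
  define P where "P a b \<longleftrightarrow> (0 \<le> a \<and> b \<le> L \<longrightarrow> subdivided g a b)" for a b
  have "P 0 L"
    using assms(2)
  proof (induction rule: Bolzano)
    case (trans a b c)
    then show ?case unfolding P_def by (auto intro: subdivided_trans)
  next
    case (local t)
    then have "t \<in> {0..L}" by simp
    then obtain \<delta> where \<delta>: "\<delta> > 0"
      "\<And>u. u \<in> {0..L} \<Longrightarrow> t \<le> u \<Longrightarrow> u < t + \<delta> \<Longrightarrow> g u = g t + of_int (slope g t 1) * (u - t)"
      "\<And>u. u \<in> {0..L} \<Longrightarrow> u \<le> t \<Longrightarrow> t - \<delta> < u \<Longrightarrow> g u = g t + of_int (slope g t (-1)) * (t - u)"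
      using locally_linear_nbhd[OF assms(1)] by blast
    have "subdivided g a b" if ab: "a \<le> t" "t \<le> b" "b - a < \<delta>" "0 \<le> a" "b \<le> L" for a b
    proof (rule subdivided_trans)
      show "subdivided g t b"
      proof (rule subdivided_cell)
        fix u assume "u \<in> {t..b}"
        then show "g u = of_int (slope g t 1) * u + (g t - of_int (slope g t 1) * t)"
          using \<delta>(2)[of u] ab by (simp add: algebra_simps)
      qed (use ab in simp)
      show "subdivided g a t"
      proof (rule subdivided_cell)
        fix u assume "u \<in> {a..t}"
        then show "g u = of_int (- slope g t (-1)) * u + (g t + of_int (slope g t (-1)) * t)"
          using \<delta>(3)[of u] ab by (simp add: algebra_simps)
      qed (use ab in simp)
    qed
    then show ?case unfolding P_def by (intro exI[of _ \<delta>]) (simp add: \<delta>(1))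
  qed
  then show ?thesis
    using subdivided_imp_sequence[of g 0 L] unfolding piecewise_linear_int_def P_def by simp
qed

section \<open>Kinks, convexity and level sets on one edge\<close>

text \<open>Away from the breakpoints the two outgoing slopes are opposite and cancel. This yields
  the finite support of \<open>metric_div\<close>.\<close>

lemma finite_kinks:
  assumes "piecewise_linear_int L g"
  shows "finite {t. 0 < t \<and> t < L \<and> slope g t 1 + slope g t (-1) \<noteq> 0}"
proof -
  obtain n x where x: "x 0 = 0" "x n = L"
    and lin: "\<And>i. i < n \<Longrightarrow> \<exists>(m::int) c. \<forall>t\<in>{x i..x (Suc i)}. g t = of_int m * t + c"
    using assms unfolding piecewise_linear_int_def by blast
  have "t \<in> x ` {..n}" if t: "0 < t" "t < L" and kink: "slope g t 1 + slope g t (-1) \<noteq> 0" for t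
  proof (rule ccontr)
    assume no: "t \<notin> x ` {..n}"
    obtain i where i: "i < n" "x i \<le> t" "t < x (Suc i)"
      using subdivision_cell_right[of x t n] x t by auto
    moreover from this have "x i \<noteq> t" using no by auto
    moreover obtain m :: int and c where "\<And>u. u \<in> {x i..x (Suc i)} \<Longrightarrow> g u = of_int m * u + c"
      using lin i(1) by blast
    ultimately have "slope g t 1 = m" "slope g t (-1) = - m"
      using linear_has_slope[of "x i" "x (Suc i)" g m c t] by (auto intro!: slope_eq)
    then show False using kink by simp
  qed
  then show ?thesis
    by (intro finite_subset[OF _ finite_imageI[of "{..n}" x]]) auto
qed

text \<open>A nonnegative sum of the outgoing slopes at a breakpoint says that the slope does not
  drop there. Hence no cell has a smaller slope than the first, and \<open>g\<close> ends on or
  above its initial tangent.\<close>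

lemma convex_endpoint_bound:
  assumes pl: "piecewise_linear_int L g" and "L > 0"
    and kinks: "\<And>t. 0 < t \<Longrightarrow> t < L \<Longrightarrow> 0 \<le> slope g t 1 + slope g t (-1)"
  shows "g 0 + of_int (slope g 0 1) * L \<le> g L"
proof -
  obtain n x where x: "x 0 = 0" "x n = L"
    and mono: "\<And>i. i < n \<Longrightarrow> x i < x (Suc i)"
    and "\<And>i. i < n \<Longrightarrow> \<exists>(m::int) c. \<forall>t\<in>{x i..x (Suc i)}. g t = of_int m * t + c"
    using assms unfolding piecewise_linear_int_def by blast
  then obtain m :: "nat \<Rightarrow> int" and c where
    lin: "\<And>i t. i < n \<Longrightarrow> t \<in> {x i..x (Suc i)} \<Longrightarrow> g t = of_int (m i) * t + c i"
    by metis
  have le: "x i \<le> x n" if "i \<le> n" for i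
    using that by (induction rule: inc_induct) (auto dest: mono)
  have s0: "slope g 0 1 = m 0" if "0 < n"
    using linear_has_slope(1)[of "x 0" "x 1" g "m 0" "c 0" 0] lin[of 0] mono[of 0] that x
    by (auto intro!: slope_eq)
  \<comment> \<open>The guard \<open>i < n\<close> is there because no cell starts at
    \<open>x n\<close>, so \<open>m n\<close> carries no information.\<close>
  have bound: "i \<le> n \<Longrightarrow> 0 \<le> x i \<and> (i < n \<longrightarrow> m 0 \<le> m i) \<and> g 0 + of_int (m 0) * x i \<le> g (x i)" for i
  proof (induction i)
    case 0
    then show ?case using x by simp
  next
    case (Suc i)
    then have i: "i < n" and IH: "0 \<le> x i" "m 0 \<le> m i" "g 0 + of_int (m 0) * x i \<le> g (x i)"
      by auto
    have inc: "x i < x (Suc i)" using mono i .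
    have "m i \<le> m (Suc i)" if "Suc i < n"
    proof -
      have "slope g (x (Suc i)) 1 = m (Suc i)"
        using linear_has_slope(1)[of "x (Suc i)" "x (Suc (Suc i))" g "m (Suc i)" "c (Suc i)" "x (Suc i)"]
          lin[of "Suc i"] mono[OF that] that by (auto intro!: slope_eq)
      moreover have "slope g (x (Suc i)) (-1) = - m i"
        using linear_has_slope(2)[of "x i" "x (Suc i)" g "m i" "c i" "x (Suc i)"]
          lin[of i] inc i by (auto intro!: slope_eq)
      moreover have "x (Suc i) < L"
        using mono[OF that] le[of "Suc (Suc i)"] that x by auto
      ultimately show ?thesis
        using kinks[of "x (Suc i)"] IH(1) inc by auto
    qed
    moreover have "of_int (m 0) * (x (Suc i) - x i) \<le> of_int (m i) * (x (Suc i) - x i)"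
      using IH(2) inc by (intro mult_right_mono) auto
    moreover have "g (x (Suc i)) - g (x i) = of_int (m i) * (x (Suc i) - x i)"
      using lin[OF i, of "x i"] lin[OF i, of "x (Suc i)"] inc by (simp add: algebra_simps)
    ultimately show ?case
      using IH inc by (auto simp: algebra_simps)
  qed
  have "0 < n" using x \<open>L > 0\<close> by (cases n) auto
  then show ?thesis using bound[of n] s0 x by simp
qed

lemma has_slope_reflect:
  "has_slope (\<lambda>u. g (L - u)) t d n \<longleftrightarrow> has_slope g (L - t) (- d) n"
  by (simp add: has_slope_def algebra_simps)

lemma slope_reflect: "slope (\<lambda>u. g (L - u)) t d = slope g (L - t) (- d)"
  by (simp add: slope_def algebra_simps)

lemma locally_linear_reflect:
  assumes "locally_linear L g"
  shows "locally_linear L (\<lambda>u. g (L - u))"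
  unfolding locally_linear_def has_slope_reflect
proof (intro allI impI)
  fix t d assume "inward L t d"
  then have "inward L (L - t) (- d)" by (auto simp: inward_def)
  then show "\<exists>n. has_slope g (L - t) (- d) n"
    using assms unfolding locally_linear_def by blast
qed

text \<open>Reversing the interval exchanges its ends and the two directions at each point, which
  preserves the kink condition.\<close>

lemma convex_endpoint_bound':
  assumes pl: "piecewise_linear_int L g" and "L > 0"
    and kinks: "\<And>t. 0 < t \<Longrightarrow> t < L \<Longrightarrow> 0 \<le> slope g t 1 + slope g t (-1)"
  shows "g L + of_int (slope g L (-1)) * L \<le> g 0"
proof -
  let ?g = "\<lambda>u. g (L - u)"
  have "piecewise_linear_int L ?g"
    using pl \<open>L > 0\<close>
    by (simp add: locally_linear_piecewise_linear_int locally_linear_reflect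
        piecewise_linear_int_locally_linear)
  moreover have "0 \<le> slope ?g t 1 + slope ?g t (-1)" if "0 < t" "t < L" for t
    using kinks[of "L - t"] that by (simp add: slope_reflect)
  ultimately have "?g 0 + of_int (slope ?g 0 1) * L \<le> ?g L"
    using convex_endpoint_bound \<open>L > 0\<close> by blast
  then show ?thesis
    by (simp add: slope_reflect)
qed

text \<open>If \<open>g\<close> were flat at every point of the level set in \<open>{a..b}\<close>,
  that set would be open and closed there, hence empty or everything, against \<open>ne\<close>. An
  end of \<open>{0..L}\<close> is also accepted as a witness, since one direction is missing
  there.\<close>

lemma level_set_kink:
  assumes lin: "locally_linear L g" and ab: "0 \<le> a" "a \<le> b" "b \<le> L"
    and ne: "(g a = c) \<noteq> (g b = c)"
  obtains t where "a \<le> t" "t \<le> b" "g t = c" "0 < t \<Longrightarrow> t < L \<Longrightarrow> slope g t 1 \<noteq> 0 \<or> slope g t (-1) \<noteq> 0"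
proof (rule ccontr)
  assume no: "\<not> thesis"
  note witness = that
  \<comment> \<open>Refuting the claim at \<open>t\<close> also yields \<open>0 < t\<close> and
    \<open>t < L\<close>, because at an end of \<open>{0..L}\<close> the last condition would hold
    vacuously.\<close>
  have flat: "slope g t 1 = 0 \<and> slope g t (-1) = 0 \<and> 0 < t \<and> t < L" if "a \<le> t" "t \<le> b" "g t = c" for t
    using no witness[OF that] by blast
  let ?T = "{t \<in> {a..b}. g t = c}"
  have cont: "continuous_on {a..b} g"
    using continuous_on_subset[OF continuous_on_locally_linear[OF lin]] ab by auto
  have "closedin (top_of_set {a..b}) ?T"
    using continuous_closedin_preimage_constant[OF cont, of c] .
  moreover have "openin (top_of_set {a..b}) ?T"
    unfolding openin_euclidean_subtopology_iff
  proof (intro conjI ballI)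
    fix t assume t: "t \<in> ?T"
    then have "t \<in> {0..L}" using ab by auto
    then obtain \<delta> where \<delta>: "\<delta> > 0"
      "\<And>u. u \<in> {0..L} \<Longrightarrow> t \<le> u \<Longrightarrow> u < t + \<delta> \<Longrightarrow> g u = g t + of_int (slope g t 1) * (u - t)"
      "\<And>u. u \<in> {0..L} \<Longrightarrow> u \<le> t \<Longrightarrow> t - \<delta> < u \<Longrightarrow> g u = g t + of_int (slope g t (-1)) * (t - u)"
      using locally_linear_nbhd[OF lin] by blast
    have "g u = c" if "u \<in> {a..b}" "dist u t < \<delta>" for u
      using \<delta>(2,3)[of u] flat[of t] t that ab by (cases "t \<le> u") (auto simp: dist_real_def)
    then show "\<exists>e>0. \<forall>x'\<in>{a..b}. dist x' t < e \<longrightarrow> x' \<in> ?T"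
      using \<delta>(1) by blast
  qed auto
  ultimately have "?T = {} \<or> ?T = {a..b}"
    using connected_clopen[THEN iffD1, OF connected_Icc, rule_format, of a b ?T] by blast
  moreover have "a \<in> {a..b}" "b \<in> {a..b}"
    using ab by simp_all
  ultimately have "a \<in> ?T \<longleftrightarrow> b \<in> ?T"
    by (elim disjE) (simp_all only: empty_iff)
  then show False
    using ne \<open>a \<in> {a..b}\<close> \<open>b \<in> {a..b}\<close> by (simp only: mem_Collect_eq simp_thms)
qed

section \<open>Rational functions on a metric graph\<close>

locale metric_graph = fin_digraph G for G :: "('a, 'b) pre_digraph" +
  fixes l :: "'b \<Rightarrow> real"
  assumes length_pos: "e \<in> arcs G \<Longrightarrow> 0 < l e"
begin

lemma edge_point_in_mpoints:
  "e \<in> arcs G \<Longrightarrow> t \<in> {0..l e} \<Longrightarrow> edge_point G l e t \<in> mpoints G l"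
  by (auto simp: edge_point_def mpoints_def)

text \<open>Continuity comes for free: in the quotient topology openness of a preimage is tested
  edge by edge, and locally linear functions are continuous. From here on only one-sided slopes
  matter.\<close>

lemma rational_function_iff:
  "rational_function G l f \<longleftrightarrow> (\<forall>e\<in>arcs G. locally_linear (l e) (f \<circ> edge_point G l e))"
proof
  assume "rational_function G l f"
  then show "\<forall>e\<in>arcs G. locally_linear (l e) (f \<circ> edge_point G l e)"
    unfolding rational_function_def using piecewise_linear_int_locally_linear by blast
next
  assume lin: "\<forall>e\<in>arcs G. locally_linear (l e) (f \<circ> edge_point G l e)"
  have "mtopology_open G l {q \<in> mpoints G l. f q \<in> U}" if "open U" for U
    unfolding mtopology_open_def
  proof (intro conjI ballI)
    fix e assume e: "e \<in> arcs G"
    then have "continuous_on {0..l e} (f \<circ> edge_point G l e)"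
      using lin continuous_on_locally_linear by blast
    then have "openin (top_of_set {0..l e}) ({0..l e} \<inter> (f \<circ> edge_point G l e) -` U)"
      using that continuous_openin_preimage_gen by blast
    moreover have "{0..l e} \<inter> (f \<circ> edge_point G l e) -` U =
        {t \<in> {0..l e}. edge_point G l e t \<in> {q \<in> mpoints G l. f q \<in> U}}"
      using edge_point_in_mpoints[OF e] by auto
    ultimately show "openin (top_of_set {0..l e})
        {t \<in> {0..l e}. edge_point G l e t \<in> {q \<in> mpoints G l. f q \<in> U}}"
      by simp
  qed auto
  then have "continuous_map (graph_topology G l) euclideanreal f"
    by (simp add: continuous_map_def openin_graph_topology
        topspace_graph_topology[OF wf_digraph_axioms length_pos])
  moreover have "piecewise_linear_int (l e) (f \<circ> edge_point G l e)" if "e \<in> arcs G" for e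
    using lin that length_pos[OF that] locally_linear_piecewise_linear_int by simp
  ultimately show "rational_function G l f"
    unfolding rational_function_def by blast
qed

lemma segments_eq:
  "segments G l p = {(e, t, d). e \<in> arcs G \<and> inward (l e) t d \<and> edge_point G l e t = p}"
  by (auto simp: segments_def inward_def)

lemma rational_has_slope:
  assumes "rational_function G l f" and "(e, t, d) \<in> segments G l p"
  shows "has_slope (f \<circ> edge_point G l e) t d (slope (f \<circ> edge_point G l e) t d)"
  using assms locally_linear_slope by (auto simp: rational_function_iff segments_eq)

lemma rational_function_add:
  assumes "rational_function G l f" and "rational_function G l g"
  shows "rational_function G l (\<lambda>q. f q + g q)"
  using assms has_slope_add unfolding rational_function_iff locally_linear_def comp_def by meson

lemma rational_function_uminus:
  assumes "rational_function G l f"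
  shows "rational_function G l (\<lambda>q. - f q)"
  using assms has_slope_uminus unfolding rational_function_iff locally_linear_def comp_def by meson

lemma rational_function_max:
  assumes "rational_function G l f"
  shows "rational_function G l (\<lambda>q. max (f q) c)"
  using assms has_slope_max unfolding rational_function_iff locally_linear_def comp_def by meson

section \<open>Orders and divisors of rational functions\<close>

lemma segments_Inner:
  assumes "e \<in> arcs G" and "0 < t" and "t < l e"
  shows "segments G l (Inner e t) = {(e, t, 1), (e, t, -1)}"
  using assms by (auto simp: segments_def edge_point_def split: if_splits)

lemma segments_Vertex:
  "segments G l (Vertex u) =
     (\<lambda>e. (e, 0, 1)) ` {e \<in> arcs G. tail G e = u} \<union> (\<lambda>e. (e, l e, -1)) ` {e \<in> arcs G. head G e = u}"
  by (auto simp: segments_def edge_point_def image_iff less_imp_le[OF length_pos] length_pos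
      dest: length_pos split: if_splits)

lemma segments_outside:
  assumes "p \<notin> mpoints G l"
  shows "segments G l p = {}"
  using assms edge_point_in_mpoints by (auto simp: segments_def)

lemma mpoints_cases:
  obtains (Vertex) u where "p = Vertex u"
  | (Inner) e t where "e \<in> arcs G" "0 < t" "t < l e" "p = Inner e t"
  | (outside) "p \<notin> mpoints G l"
  by (cases p) (auto simp: mpoints_def)

lemma ord_at_outside: "p \<notin> mpoints G l \<Longrightarrow> ord_at G l f p = 0"
  by (simp add: ord_at_def segments_outside)

lemma ord_at_Inner:
  assumes "e \<in> arcs G" and "0 < t" and "t < l e"
  shows "ord_at G l f (Inner e t) =
    slope (f \<circ> edge_point G l e) t 1 + slope (f \<circ> edge_point G l e) t (-1)"
  by (simp add: ord_at_def segments_Inner[OF assms])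

text \<open>Segments leaving from a tail and from a head differ in their direction, so the two
  families are disjoint and a loop is counted once in each sum.\<close>

lemma ord_at_Vertex:
  "ord_at G l f (Vertex u) =
     (\<Sum>e | e \<in> arcs G \<and> tail G e = u. slope (f \<circ> edge_point G l e) 0 1) +
     (\<Sum>e | e \<in> arcs G \<and> head G e = u. slope (f \<circ> edge_point G l e) (l e) (-1))"
proof -
  have "ord_at G l f (Vertex u) =
      (\<Sum>(e, t, d)\<in>(\<lambda>e. (e, 0, 1)) ` {e \<in> arcs G. tail G e = u}. slope (f \<circ> edge_point G l e) t d) +
      (\<Sum>(e, t, d)\<in>(\<lambda>e. (e, l e, -1)) ` {e \<in> arcs G. head G e = u}. slope (f \<circ> edge_point G l e) t d)"
    unfolding ord_at_def segments_Vertex by (intro sum.union_disjoint) auto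
  then show ?thesis
    by (simp add: sum.reindex inj_on_def)
qed

lemma ord_at_add:
  assumes "rational_function G l f" and "rational_function G l g"
  shows "ord_at G l (\<lambda>q. f q + g q) p = ord_at G l f p + ord_at G l g p"
  unfolding ord_at_def sum.distrib[symmetric]
  using slope_eq[OF has_slope_add[OF rational_has_slope[OF assms(1)] rational_has_slope[OF assms(2)]]]
  by (intro sum.cong) (auto simp: comp_def)

lemma ord_at_uminus:
  assumes "rational_function G l f"
  shows "ord_at G l (\<lambda>q. - f q) p = - ord_at G l f p"
  unfolding ord_at_def sum_negf[symmetric]
  using slope_eq[OF has_slope_uminus[OF rational_has_slope[OF assms(1)]]]
  by (intro sum.cong) (auto simp: comp_def)

lemma slope_max:
  assumes "rational_function G l f" and "(e, t, d) \<in> segments G l p"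
  shows "slope ((\<lambda>q. max (f q) c) \<circ> edge_point G l e) t d =
    (if c < f p then slope (f \<circ> edge_point G l e) t d
     else if f p = c then max (slope (f \<circ> edge_point G l e) t d) 0 else 0)"
proof -
  have "edge_point G l e t = p"
    using assms(2) by (simp add: segments_def)
  then show ?thesis
    using slope_eq[OF has_slope_max[OF rational_has_slope[OF assms]], of c] by (simp add: comp_def)
qed

text \<open>The truncation equals \<open>c\<close> at \<open>p\<close> and is nowhere smaller, so no
  outgoing slope is negative. Together with \<open>ord_at_max_ge\<close>, truncation keeps a divisor
  effective if it is effective both before and after adding the divisor of \<open>f\<close>.\<close>

lemma ord_at_max_nonneg:
  assumes "rational_function G l f" and "f p \<le> c"
  shows "0 \<le> ord_at G l (\<lambda>q. max (f q) c) p"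
  unfolding ord_at_def using assms by (intro sum_nonneg) (auto simp: slope_max)

lemma ord_at_max_ge:
  assumes "rational_function G l f" and "c \<le> f p"
  shows "ord_at G l f p \<le> ord_at G l (\<lambda>q. max (f q) c) p"
  unfolding ord_at_def using assms by (intro sum_mono) (auto simp: slope_max)

lemma finite_ord_at_support:
  assumes "rational_function G l f"
  shows "finite {p \<in> mpoints G l. ord_at G l f p \<noteq> 0}"
proof (rule finite_subset)
  let ?K = "\<lambda>e. {t. 0 < t \<and> t < l e \<and>
    slope (f \<circ> edge_point G l e) t 1 + slope (f \<circ> edge_point G l e) t (-1) \<noteq> 0}"
  show "{p \<in> mpoints G l. ord_at G l f p \<noteq> 0} \<subseteq> Vertex ` verts G \<union> (\<Union>e\<in>arcs G. Inner e ` ?K e)"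
    by (auto simp: mpoints_def ord_at_Inner)
  have "finite (?K e)" if "e \<in> arcs G" for e
    using assms that finite_kinks unfolding rational_function_def by blast
  then show "finite (Vertex ` verts G \<union> (\<Union>e\<in>arcs G. Inner e ` ?K e))"
    by simp
qed

text \<open>Outside \<open>mpoints G l\<close> there are no segments and the order is zero, so the
  formula holds for every \<open>p\<close>.\<close>

lemma lookup_metric_div:
  assumes "rational_function G l f"
  shows "Poly_Mapping.lookup (metric_div G l f) p = ord_at G l f p"
proof -
  let ?S = "{p \<in> mpoints G l. ord_at G l f p \<noteq> 0}"
  have "Poly_Mapping.lookup (metric_div G l f) p = (\<Sum>q\<in>?S. if p = q then ord_at G l f q else 0)"
    unfolding metric_div_def Poly_Mapping.lookup_sum by (intro sum.cong) auto
  also have "\<dots> = ord_at G l f p"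
    using finite_ord_at_support[OF assms] ord_at_outside[of p f] by (auto simp: sum.delta)
  finally show ?thesis .
qed

lemma metric_div_in_divisors:
  assumes "rational_function G l f"
  shows "metric_div G l f \<in> divisors (mpoints G l)"
proof -
  have "p \<in> mpoints G l" if "p \<in> Poly_Mapping.keys (metric_div G l f)" for p
    using that ord_at_outside[of p f] by (auto simp: in_keys_iff lookup_metric_div[OF assms])
  then show ?thesis
    unfolding divisors_def by blast
qed

section \<open>Vertices determine the rank\<close>

text \<open>At its own level both slopes turn into their positive parts. If one slope is positive,
  the new order is at least 1; otherwise the old order is at most -1, and its sum with
  \<open>a\<close> being nonnegative forces \<open>1 \<le> a\<close>.\<close>

lemma max_chip_at_kink:
  assumes h: "rational_function G l h" and e: "e \<in> arcs G" and t: "0 < t" "t < l e"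
    and kink: "slope (h \<circ> edge_point G l e) t 1 \<noteq> 0 \<or> slope (h \<circ> edge_point G l e) t (-1) \<noteq> 0"
    and a: "0 \<le> a" "0 \<le> a + ord_at G l h (Inner e t)"
  shows "1 \<le> a + ord_at G l (\<lambda>q. max (h q) (h (Inner e t))) (Inner e t)"
proof -
  have "slope ((\<lambda>q. max (h q) (h (Inner e t))) \<circ> edge_point G l e) t d =
      max (slope (h \<circ> edge_point G l e) t d) 0" if "d = 1 \<or> d = -1" for d
    using slope_max[OF h, of e t d "Inner e t"] that segments_Inner[OF e t] by auto
  then show ?thesis
    using kink a by (auto simp: ord_at_Inner[OF e t] max_def)
qed

end

section \<open>Chips approaching each other along an edge\<close>

text \<open>The negative of a trapezoid of height \<open>r\<close> over \<open>{x..y}\<close>. Under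
  the bounds of \<open>bump_slopes\<close> its divisor takes one chip from each of \<open>x\<close>
  and \<open>y\<close> and drops them at \<open>x + r\<close> and \<open>y - r\<close>.\<close>

definition bump :: "real \<Rightarrow> real \<Rightarrow> real \<Rightarrow> real \<Rightarrow> real" where
  "bump x y r t = - max 0 (min r (min (t - x) (y - t)))"

lemma bump_slopes:
  assumes "0 < r" and "x + r \<le> y - r"
  shows "has_slope (bump x y r) t 1
      (if x \<le> t \<and> t < x + r then -1 else if y - r \<le> t \<and> t < y then 1 else 0)" (is ?right)
    and "has_slope (bump x y r) t (-1)
      (if x < t \<and> t \<le> x + r then 1 else if y - r < t \<and> t \<le> y then -1 else 0)" (is ?left)
proof -
  consider "t < x" | "x \<le> t" "t < x + r" | "x + r \<le> t" "t < y - r" | "y - r \<le> t" "t < y" | "y \<le> t"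
    by linarith
  then show ?right
  proof cases
    case 1 then show ?thesis
      by (intro has_slopeI[of "x - t"]) (use assms in \<open>auto simp: bump_def\<close>)
  next
    case 2 then show ?thesis
      by (intro has_slopeI[of "x + r - t"]) (use assms in \<open>auto simp: bump_def\<close>)
  next
    case 3 then show ?thesis
      by (intro has_slopeI[of "y - r - t"]) (use assms in \<open>auto simp: bump_def\<close>)
  next
    case 4 then show ?thesis
      by (intro has_slopeI[of "y - t"]) (use assms in \<open>auto simp: bump_def\<close>)
  next
    case 5 then show ?thesis
      by (intro has_slopeI[of 1]) (use assms in \<open>auto simp: bump_def\<close>)
  qed
  consider "t \<le> x" | "x < t" "t \<le> x + r" | "x + r < t" "t \<le> y - r" | "y - r < t" "t \<le> y" | "y < t"
    by linarith
  then show ?left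
  proof cases
    case 1 then show ?thesis
      by (intro has_slopeI[of 1]) (use assms in \<open>auto simp: bump_def\<close>)
  next
    case 2 then show ?thesis
      by (intro has_slopeI[of "t - x"]) (use assms in \<open>auto simp: bump_def\<close>)
  next
    case 3 then show ?thesis
      by (intro has_slopeI[of "t - (x + r)"]) (use assms in \<open>auto simp: bump_def\<close>)
  next
    case 4 then show ?thesis
      by (intro has_slopeI[of "t - (y - r)"]) (use assms in \<open>auto simp: bump_def\<close>)
  next
    case 5 then show ?thesis
      by (intro has_slopeI[of "t - y"]) (use assms in \<open>auto simp: bump_def\<close>)
  qed
qed

context metric_graph
begin

lemma move_chips_to_middle:
  fixes c :: "('a, 'b) mpoint \<Rightarrow> int"
  assumes e: "e \<in> arcs G" and no_loop: "tail G e \<noteq> head G e"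
    and xsy: "0 \<le> x" "x \<le> s" "s \<le> y" "y \<le> l e" and s: "0 < s" "s < l e"
    and c: "\<And>q. 0 \<le> c q" "1 \<le> c (edge_point G l e x)" "1 \<le> c (edge_point G l e y)"
  obtains g where "rational_function G l g"
    and "\<And>q. of_bool (q = Inner e s) \<le> c q + ord_at G l g q"
proof (cases "x = s \<or> y = s")
  case True
  have zero: "has_slope (\<lambda>u. 0) t d 0" for t d
    by (simp add: has_slope_def)
  have "rational_function G l (\<lambda>q. 0)"
    unfolding rational_function_iff locally_linear_def comp_def using zero by blast
  moreover have "ord_at G l (\<lambda>q. 0) q = 0" for q
    by (simp add: ord_at_def comp_def slope_eq[OF zero] case_prod_unfold)
  moreover have "1 \<le> c (Inner e s)"
    using True c s by (auto simp: edge_point_def)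
  ultimately show thesis
    using that[of "\<lambda>q. 0"] c(1) by auto
next
  case False
  \<comment> \<open>With \<open>r\<close> the distance from \<open>s\<close> to the nearer chip,
    that chip lands exactly on \<open>s\<close> and the other does not pass it.\<close>
  define r where "r = min (s - x) (y - s)"
  have r: "0 < r" "x + r \<le> y - r" "s = x + r \<or> s = y - r"
    using False xsy by (auto simp: r_def min_def)
  define g :: "('a, 'b) mpoint \<Rightarrow> real" where
    "g q = (case q of Vertex _ \<Rightarrow> 0 | Inner e' t \<Rightarrow> if e' = e then bump x y r t else 0)" for q
  \<comment> \<open>Both ends of the edge lie outside the open interval from \<open>x\<close> to
    \<open>y\<close>, so the trapezoid vanishes there and matches the value 0 at vertices.\<close>
  have g_edge: "(g \<circ> edge_point G l e') u = (if e' = e then bump x y r u else 0)"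
    if "e' \<in> arcs G" "u \<in> {0..l e'}" for e' u
    using that xsy r by (auto simp: g_def edge_point_def bump_def)
  define sl :: "'b \<Rightarrow> real \<Rightarrow> real \<Rightarrow> int" where
    "sl e' t d = (if e' \<noteq> e then 0
      else if d = 1 then (if x \<le> t \<and> t < x + r then -1 else if y - r \<le> t \<and> t < y then 1 else 0)
      else (if x < t \<and> t \<le> x + r then 1 else if y - r < t \<and> t \<le> y then -1 else 0))" for e' t d
  have slope_g: "has_slope (g \<circ> edge_point G l e') t d (sl e' t d)"
    if e': "e' \<in> arcs G" and d: "inward (l e') t d" for e' t d
  proof -
    have "has_slope (\<lambda>u. if e' = e then bump x y r u else 0) t d (sl e' t d)"
    proof (cases "e' = e")
      case True
      then show ?thesis
        using bump_slopes[OF r(1,2), of t] d by (auto simp: sl_def inward_def)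
    qed (simp add: sl_def has_slope_def)
    moreover have "has_slope (g \<circ> edge_point G l e') t d (sl e' t d) \<longleftrightarrow>
        has_slope (\<lambda>u. if e' = e then bump x y r u else 0) t d (sl e' t d)"
      by (rule has_slope_cong[OF d]) (rule g_edge[OF e'])
    ultimately show ?thesis by blast
  qed
  show thesis
  proof (rule that)
    show "rational_function G l g"
      unfolding rational_function_iff locally_linear_def using slope_g by blast
  next
    fix q :: "('a, 'b) mpoint"
    let ?X = "edge_point G l e x" and ?Y = "edge_point G l e y"
    \<comment> \<open>If \<open>x = 0\<close> and \<open>y = l e\<close>, both chips sit on
      vertices; \<open>no_loop\<close> makes these distinct, so one chip at each suffices.\<close>
    have XY: "?X \<noteq> ?Y" "?X \<noteq> Inner e s" "?Y \<noteq> Inner e s"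
      using no_loop False xsy r s by (auto simp: edge_point_def)
    have "of_bool (q = Inner e s) - of_bool (q = ?X) - of_bool (q = ?Y) \<le> ord_at G l g q"
    proof (cases q rule: mpoints_cases)
      case (Vertex u)
      have "slope (g \<circ> edge_point G l e') 0 1 = (if e' = e then - of_bool (x = 0) else 0)"
        if "e' \<in> arcs G" for e'
        using slope_eq[OF slope_g[OF that, of 0 1]] length_pos[OF that] xsy r
        by (auto simp: inward_def sl_def)
      then have tails: "(\<Sum>e' | e' \<in> arcs G \<and> tail G e' = u. slope (g \<circ> edge_point G l e') 0 1) =
          - of_bool (tail G e = u \<and> x = 0)"
        using e by (simp add: sum.delta)
      have "slope (g \<circ> edge_point G l e') (l e') (-1) = (if e' = e then - of_bool (y = l e) else 0)"
        if "e' \<in> arcs G" for e'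
        using slope_eq[OF slope_g[OF that, of "l e'" "-1"]] length_pos[OF that] xsy r
        by (auto simp: inward_def sl_def)
      then have heads: "(\<Sum>e' | e' \<in> arcs G \<and> head G e' = u. slope (g \<circ> edge_point G l e') (l e') (-1)) =
          - of_bool (head G e = u \<and> y = l e)"
        using e by (simp add: sum.delta)
      show ?thesis
        unfolding Vertex ord_at_Vertex tails heads using xsy s by (auto simp: edge_point_def)
    next
      case (Inner e' t)
      have "ord_at G l g q = sl e' t 1 + sl e' t (-1)"
        using Inner slope_eq[OF slope_g[of e' t 1]] slope_eq[OF slope_g[of e' t "-1"]]
        by (simp add: ord_at_Inner inward_def)
      moreover have "q = ?X \<longleftrightarrow> e' = e \<and> t = x" "q = ?Y \<longleftrightarrow> e' = e \<and> t = y"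
        using Inner xsy by (auto simp: edge_point_def)
      ultimately show ?thesis
        using Inner r by (auto simp: sl_def)
    next
      case outside
      then have "q \<noteq> Inner e s"
        using e s by (auto simp: mpoints_def)
      then show ?thesis
        using outside by (simp add: ord_at_outside)
    qed
    then show "of_bool (q = Inner e s) \<le> c q + ord_at G l g q"
      using c(1)[of q] c(2,3) XY by (cases "q = ?X"; cases "q = ?Y") auto
  qed
qed

text \<open>
  After the truncation \<open>m\<close> there is a chip wherever the level set of \<open>h\<close> through the point stops inside
  the edge; a level set running into a vertex instead meets the chip given there.
\<close>

lemma chip_to_inner_point:
  fixes c :: "('a, 'b) mpoint \<Rightarrow> int"
  assumes e: "e \<in> arcs G" and no_loop: "tail G e \<noteq> head G e" and s: "0 < s" "s < l e"
    and h: "rational_function G l h"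
    and c: "\<And>q. 0 \<le> c q" "1 \<le> c (Vertex (tail G e))"
    and c': "\<And>q. 0 \<le> c q + ord_at G l h q"
      "1 \<le> c (Vertex (head G e)) + ord_at G l h (Vertex (head G e))"
  obtains f where "rational_function G l f"
    and "\<And>q. of_bool (q = Inner e s) \<le> c q + ord_at G l f q"
proof -
  let ?h = "h \<circ> edge_point G l e"
  define k where "k = ?h s"
  have lin: "locally_linear (l e) ?h"
    using h e by (simp add: rational_function_iff)
  define m where "m = (\<lambda>q. max (h q) k)"
  have m: "rational_function G l m"
    unfolding m_def using rational_function_max[OF h] .
  define c3 where "c3 q = c q + ord_at G l m q" for q
  have c3_ge: "c q \<le> c3 q" if "h q \<le> k" for q
    using ord_at_max_nonneg[OF h that] by (simp add: c3_def m_def)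
  have c3_ge': "c q + ord_at G l h q \<le> c3 q" if "k \<le> h q" for q
    using ord_at_max_ge[OF h that] by (simp add: c3_def m_def)
  \<comment> \<open>Up to level \<open>k\<close> the new divisor dominates \<open>c\<close>, from
    level \<open>k\<close> on it dominates \<open>c\<close> plus the divisor of \<open>h\<close>,
    and both are effective.\<close>
  have c3_nonneg: "0 \<le> c3 q" for q
    using c3_ge[of q] c3_ge'[of q] c(1)[of q] c'(1)[of q] by linarith
  have kink: "1 \<le> c3 (edge_point G l e t)"
    if "0 < t" "t < l e" "?h t = k" "slope ?h t 1 \<noteq> 0 \<or> slope ?h t (-1) \<noteq> 0" for t
    using max_chip_at_kink[OF h e that(1,2,4) c(1)[of "Inner e t"] c'(1)] that(1-3)
    by (simp add: c3_def m_def edge_point_def)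
  \<comment> \<open>At level \<open>k\<close> both comparisons apply: a chip at the tail is
    inherited from \<open>c\<close>, and one at the head, in the choice of \<open>y\<close>, from
    \<open>c\<close> plus the divisor of \<open>h\<close>.\<close>
  obtain x where x: "0 \<le> x" "x \<le> s" "1 \<le> c3 (edge_point G l e x)"
  proof (cases "?h 0 = k")
    case True
    then show thesis
      using that[of 0] c3_ge[of "Vertex (tail G e)"] c(2) s by (simp add: edge_point_def)
  next
    case False
    then have "(?h 0 = k) \<noteq> (?h s = k)" by (simp add: k_def)
    then obtain t where t: "0 \<le> t" "t \<le> s" "?h t = k"
      "0 < t \<Longrightarrow> t < l e \<Longrightarrow> slope ?h t 1 \<noteq> 0 \<or> slope ?h t (-1) \<noteq> 0"
      using level_set_kink[OF lin, of 0 s k] s by (metis less_imp_le order_refl)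
    then have "t \<noteq> 0" using False by auto
    then show thesis
      using that[of t] t kink[of t] s by auto
  qed
  obtain y where y: "s \<le> y" "y \<le> l e" "1 \<le> c3 (edge_point G l e y)"
  proof (cases "?h (l e) = k")
    case True
    then show thesis
      using that[of "l e"] c3_ge'[of "Vertex (head G e)"] c'(2) s by (simp add: edge_point_def)
  next
    case False
    then have "(?h s = k) \<noteq> (?h (l e) = k)" by (simp add: k_def)
    then obtain t where t: "s \<le> t" "t \<le> l e" "?h t = k"
      "0 < t \<Longrightarrow> t < l e \<Longrightarrow> slope ?h t 1 \<noteq> 0 \<or> slope ?h t (-1) \<noteq> 0"
      using level_set_kink[OF lin, of s "l e" k] s by (metis less_imp_le order_refl)
    then have "t \<noteq> l e" using False by auto
    then show thesis
      using that[of t] t kink[of t] s by auto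
  qed
  obtain g where g: "rational_function G l g"
    "\<And>q. of_bool (q = Inner e s) \<le> c3 q + ord_at G l g q"
    using move_chips_to_middle[OF e no_loop x(1,2) y(1,2) s c3_nonneg x(3) y(3)] by blast
  show thesis
    by (rule that[OF rational_function_add[OF m g(1)]])
      (use g(2) in \<open>simp add: ord_at_add[OF m g(1)] c3_def add.assoc\<close>)
qed

text \<open>A member of the linear system is determined by its rational function, and
  \<open>metric_div\<close> is supported on points of the graph. The resulting inequality lets
  functions be added without returning to divisors.\<close>

lemma linear_system_nonempty_iff:
  "linear_system (mpoints G l) (metric_equiv G l) D \<noteq> {} \<longleftrightarrow>
    D \<in> divisors (mpoints G l) \<and>
    (\<exists>f. rational_function G l f \<and> (\<forall>q. 0 \<le> Poly_Mapping.lookup D q + ord_at G l f q))"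
  (is "?lhs \<longleftrightarrow> ?rhs")
proof
  assume ?lhs
  then obtain E f where E: "E \<in> divisors (mpoints G l)" "effective E"
    and f: "rational_function G l f" and "E = D + metric_div G l f"
    unfolding linear_system_def metric_equiv_def by blast
  moreover from this have "D = E - metric_div G l f" by simp
  then have "D \<in> divisors (mpoints G l)"
    using E(1) metric_div_in_divisors[OF f] keys_diff[of E "metric_div G l f"]
    unfolding divisors_def by blast
  ultimately show ?rhs
    unfolding effective_def by (auto simp: Poly_Mapping.lookup_add lookup_metric_div intro!: exI[of _ f])
next
  assume ?rhs
  then obtain f where D: "D \<in> divisors (mpoints G l)" and f: "rational_function G l f"
    and pos: "\<And>q. 0 \<le> Poly_Mapping.lookup D q + ord_at G l f q"
    by blast
  have "D + metric_div G l f \<in> divisors (mpoints G l)"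
    using D metric_div_in_divisors[OF f] Poly_Mapping.keys_add[of D "metric_div G l f"]
    unfolding divisors_def by blast
  moreover have "effective (D + metric_div G l f)"
    unfolding effective_def using pos by (simp add: Poly_Mapping.lookup_add lookup_metric_div[OF f])
  moreover have "metric_equiv G l (D + metric_div G l f) D"
    unfolding metric_equiv_def using f by blast
  ultimately show ?lhs
    unfolding linear_system_def by blast
qed

text \<open>Only inner points need work: the ends of the edge supply \<open>f1\<close> and
  \<open>f2\<close>, whose difference carries a configuration with a chip at the tail to one with a
  chip at the head, as \<open>chip_to_inner_point\<close> asks.\<close>

lemma linear_system_minus_point:
  assumes no_loops: "\<And>e. e \<in> arcs G \<Longrightarrow> tail G e \<noteq> head G e"
    and vertices: "\<And>v. v \<in> verts G \<Longrightarrow>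
      linear_system (mpoints G l) (metric_equiv G l) (D - frag_of (Vertex v)) \<noteq> {}"
    and p: "p \<in> mpoints G l"
  shows "linear_system (mpoints G l) (metric_equiv G l) (D - frag_of p) \<noteq> {}"
proof (cases p rule: mpoints_cases)
  case (Vertex u)
  then show ?thesis using vertices p by (auto simp: mpoints_def)
next
  case outside
  then show ?thesis using p by blast
next
  case (Inner e s)
  let ?v = "Vertex (tail G e) :: ('a, 'b) mpoint" and ?w = "Vertex (head G e) :: ('a, 'b) mpoint"
  note ends = tail_in_verts[OF Inner(1)] head_in_verts[OF Inner(1)]
  obtain f1 where Dv: "D - frag_of ?v \<in> divisors (mpoints G l)" and f1: "rational_function G l f1"
    and c1: "\<And>q. 0 \<le> Poly_Mapping.lookup (D - frag_of ?v) q + ord_at G l f1 q"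
    using vertices[OF ends(1)] linear_system_nonempty_iff by blast
  obtain f2 where f2: "rational_function G l f2"
    and c2: "\<And>q. 0 \<le> Poly_Mapping.lookup (D - frag_of ?w) q + ord_at G l f2 q"
    using vertices[OF ends(2)] linear_system_nonempty_iff by blast
  have neg: "rational_function G l (\<lambda>q. - f1 q)"
    using rational_function_uminus[OF f1] .
  define h where "h = (\<lambda>q. f2 q + - f1 q)"
  have h: "rational_function G l h"
    unfolding h_def by (rule rational_function_add[OF f2 neg])
  have ord_h: "ord_at G l h q = ord_at G l f2 q - ord_at G l f1 q" for q
    unfolding h_def ord_at_add[OF f2 neg] ord_at_uminus[OF f1] by simp
  \<comment> \<open>Configurations are measured from the divisor reached by \<open>f1\<close>, so
    that adding the divisor of \<open>h\<close> gives the one reached by \<open>f2\<close>.\<close>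
  define c where "c q = Poly_Mapping.lookup D q + ord_at G l f1 q" for q
  have c_ge: "of_bool (q = ?v) \<le> c q" for q
    using c1[of q] by (auto simp: c_def Poly_Mapping.lookup_minus split: if_splits)
  have c'_ge: "of_bool (q = ?w) \<le> c q + ord_at G l h q" for q
    using c2[of q] by (auto simp: c_def ord_h Poly_Mapping.lookup_minus split: if_splits)
  obtain f where f: "rational_function G l f"
    "\<And>q. of_bool (q = Inner e s) \<le> c q + ord_at G l f q"
  proof (rule chip_to_inner_point[OF Inner(1) no_loops[OF Inner(1)] Inner(2,3) h, of c])
    show "0 \<le> c q" for q by (rule order_trans[OF _ c_ge[of q]]) simp
    show "1 \<le> c ?v" using c_ge[of ?v] by simp
    show "0 \<le> c q + ord_at G l h q" for q by (rule order_trans[OF _ c'_ge[of q]]) simp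
    show "1 \<le> c ?w + ord_at G l h ?w" using c'_ge[of ?w] by simp
  qed (rule that)
  have "D - frag_of p = (D - frag_of ?v) + (frag_of ?v - frag_of p)" by simp
  moreover have "?v \<in> mpoints G l" using ends by (simp add: mpoints_def)
  ultimately have "D - frag_of p \<in> divisors (mpoints G l)"
    using Dv p Poly_Mapping.keys_add[of "D - frag_of ?v" "frag_of ?v - frag_of p"]
      keys_diff[of "frag_of ?v" "frag_of p"]
    unfolding divisors_def by auto
  moreover have "0 \<le> Poly_Mapping.lookup (D - frag_of p) q + ord_at G l (\<lambda>q. f1 q + f q) q" for q
    using f(2)[of q] Inner(4)
    by (auto simp: ord_at_add[OF f1 f(1)] c_def Poly_Mapping.lookup_minus split: if_splits)
  ultimately show ?thesis
    using rational_function_add[OF f1 f(1)] linear_system_nonempty_iff by blast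
qed

end

section \<open>Effective divisors\<close>

lemma deg_eq_sum:
  assumes "finite A" and "Poly_Mapping.keys D \<subseteq> A"
  shows "deg D = (\<Sum>p\<in>A. Poly_Mapping.lookup D p)"
  unfolding deg_def using assms by (intro sum.mono_neutral_left) (auto simp: in_keys_iff)

lemma deg_add_frag_of: "deg (D + frag_of p) = deg D + 1"
proof -
  let ?A = "insert p (Poly_Mapping.keys D)"
  have "deg (D + frag_of p) = (\<Sum>q\<in>?A. Poly_Mapping.lookup (D + frag_of p) q)"
    using Poly_Mapping.keys_add[of D "frag_of p"] by (intro deg_eq_sum) auto
  also have "\<dots> = (\<Sum>q\<in>?A. Poly_Mapping.lookup D q) + (\<Sum>q\<in>?A. if q = p then 1 else 0)"
    by (simp add: Poly_Mapping.lookup_add sum.distrib)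
  also have "(\<Sum>q\<in>?A. Poly_Mapping.lookup D q) = deg D"
    by (intro deg_eq_sum[symmetric]) auto
  also have "(\<Sum>q\<in>?A. if q = p then 1 else 0) = (1::int)"
    by (subst sum.delta) auto
  finally show ?thesis .
qed

lemma effective_add_frag_of: "effective D \<Longrightarrow> effective (D + frag_of p)"
  by (simp add: effective_def Poly_Mapping.lookup_add)

lemma divisors_add_frag_of: "D \<in> divisors P \<Longrightarrow> p \<in> P \<Longrightarrow> D + frag_of p \<in> divisors P"
  using Poly_Mapping.keys_add[of D "frag_of p"] by (auto simp: divisors_def)

text \<open>Removing a chip from a point of the support keeps the divisor effective and lowers its
  nonnegative degree by one.\<close>

lemma effective_divisor_induct [consumes 2, case_names zero add]:
  assumes "E \<in> divisors P" and "effective E"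
    and zero: "Q 0"
    and add: "\<And>E p. E \<in> divisors P \<Longrightarrow> effective E \<Longrightarrow> p \<in> P \<Longrightarrow> Q E \<Longrightarrow> Q (E + frag_of p)"
  shows "Q E"
  using assms(1,2)
proof (induction "nat (deg E)" arbitrary: E rule: less_induct)
  case less
  show ?case
  proof (cases "Poly_Mapping.keys E = {}")
    case True
    then show ?thesis using zero by simp
  next
    case False
    then obtain p where p: "p \<in> Poly_Mapping.keys E" by blast
    then have pos: "0 < Poly_Mapping.lookup E p"
      using less.prems(2) by (metis effective_def in_keys_iff order_le_less)
    have "p \<in> P" using p less.prems(1) by (auto simp: divisors_def)
    define E' where "E' = E - frag_of p"
    have E: "E = E' + frag_of p" by (simp add: E'_def)
    have "effective E'"
      using less.prems(2) pos by (auto simp: effective_def E'_def Poly_Mapping.lookup_minus)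
    moreover have "E' \<in> divisors P"
      using less.prems(1) \<open>p \<in> P\<close> keys_diff[of E "frag_of p"] by (auto simp: divisors_def E'_def)
    moreover have "0 \<le> deg E'"
      using \<open>effective E'\<close> by (auto simp: deg_def effective_def intro: sum_nonneg)
    then have "nat (deg E') < nat (deg E)"
      by (simp add: E deg_add_frag_of)
    ultimately show ?thesis
      using add \<open>p \<in> P\<close> less.hyps unfolding E by blast
  qed
qed

section \<open>Divisors supported on vertices\<close>

lemma lookup_vertex_divisor:
  "Poly_Mapping.lookup (vertex_divisor D) (Vertex v) = Poly_Mapping.lookup D v"
  "Poly_Mapping.lookup (vertex_divisor D) (Inner e t) = 0"
proof -
  have "Poly_Mapping.lookup (vertex_divisor D) (Vertex v) =
      (\<Sum>u\<in>Poly_Mapping.keys D. if v = u then Poly_Mapping.lookup D u else 0)"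
    unfolding vertex_divisor_def frag_extend_def Poly_Mapping.lookup_sum by (intro sum.cong) auto
  then show "Poly_Mapping.lookup (vertex_divisor D) (Vertex v) = Poly_Mapping.lookup D v"
    by (simp add: sum.delta in_keys_iff split: if_splits)
  show "Poly_Mapping.lookup (vertex_divisor D) (Inner e t) = 0"
    unfolding vertex_divisor_def frag_extend_def Poly_Mapping.lookup_sum by simp
qed

lemma keys_vertex_divisor: "Poly_Mapping.keys (vertex_divisor D) = Vertex ` Poly_Mapping.keys D"
proof (rule set_eqI)
  show "p \<in> Poly_Mapping.keys (vertex_divisor D) \<longleftrightarrow> p \<in> Vertex ` Poly_Mapping.keys D" for p
    by (cases p) (auto simp: in_keys_iff lookup_vertex_divisor)
qed

lemma deg_vertex_divisor: "deg (vertex_divisor D) = deg D"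
  by (simp add: deg_def keys_vertex_divisor sum.reindex inj_on_def lookup_vertex_divisor)

lemma effective_vertex_divisor: "effective D \<Longrightarrow> effective (vertex_divisor D)"
  unfolding effective_def using lookup_vertex_divisor by (metis mpoint.exhaust order_refl)

lemma vertex_divisor_in_divisors:
  "D \<in> divisors (verts G) \<Longrightarrow> vertex_divisor D \<in> divisors (mpoints G l)"
  by (auto simp: divisors_def keys_vertex_divisor mpoints_def)

lemma vertex_divisor_add: "vertex_divisor (D + D') = vertex_divisor D + vertex_divisor D'"
  by (simp add: vertex_divisor_def frag_extend_add)

lemma vertex_divisor_diff: "vertex_divisor (D - D') = vertex_divisor D - vertex_divisor D'"
  by (simp add: vertex_divisor_def frag_extend_diff)

lemma vertex_divisor_frag_of: "vertex_divisor (frag_of v) = frag_of (Vertex v)"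
  by (simp add: vertex_divisor_def)

text \<open>The contrapositive of \<open>linear_system_minus_point\<close> trades one chip of
  \<open>E\<close> for a vertex while the linear system stays empty. \<open>D\<close> varies in the
  induction because the chips not being moved are absorbed into it.\<close>

lemma (in metric_graph) move_divisor_to_vertices:
  assumes no_loops: "\<And>e. e \<in> arcs G \<Longrightarrow> tail G e \<noteq> head G e"
    and "E \<in> divisors (mpoints G l)" and "effective E"
    and "linear_system (mpoints G l) (metric_equiv G l) (D - E) = {}"
  shows "\<exists>E'\<in>divisors (verts G). effective E' \<and> deg E' = deg E \<and>
    linear_system (mpoints G l) (metric_equiv G l) (D - vertex_divisor E') = {}"
  using assms(2-)
proof (induction E arbitrary: D rule: effective_divisor_induct)
  case zero
  then show ?case
    by (intro bexI[of _ 0]) (auto simp: divisors_def effective_def deg_def vertex_divisor_def)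
next
  case (add E p)
  have "linear_system (mpoints G l) (metric_equiv G l) (D - frag_of p - E) = {}"
    using add.prems by (simp add: algebra_simps)
  then obtain E' where E': "E' \<in> divisors (verts G)" "effective E'" "deg E' = deg E"
    and "linear_system (mpoints G l) (metric_equiv G l) (D - frag_of p - vertex_divisor E') = {}"
    using add.IH by blast
  \<comment> \<open>The vertex chips already found go into the base divisor, which leaves
    \<open>p\<close> as the single chip to replace.\<close>
  then have "linear_system (mpoints G l) (metric_equiv G l) (D - vertex_divisor E' - frag_of p) = {}"
    by (simp add: algebra_simps)
  then obtain v where v: "v \<in> verts G" and
    "linear_system (mpoints G l) (metric_equiv G l) (D - vertex_divisor E' - frag_of (Vertex v)) = {}"
    using linear_system_minus_point[OF no_loops] \<open>p \<in> mpoints G l\<close> by blast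
  then have "linear_system (mpoints G l) (metric_equiv G l)
      (D - vertex_divisor (E' + frag_of v)) = {}"
    by (simp add: vertex_divisor_add vertex_divisor_frag_of algebra_simps)
  then show ?case
    using E' v by (intro bexI[of _ "E' + frag_of v"])
      (auto simp: deg_add_frag_of effective_add_frag_of divisors_add_frag_of)
qed

section \<open>Edges of length one\<close>

context fin_digraph
begin

lemma lookup_graph_div:
  "Poly_Mapping.lookup (graph_div G f) u =
     (\<Sum>e | e \<in> arcs G \<and> tail G e = u. f u - f (head G e)) +
     (\<Sum>e | e \<in> arcs G \<and> head G e = u. f u - f (tail G e))" (is "_ = ?c u")
proof -
  have "Poly_Mapping.lookup (graph_div G f) u = (\<Sum>v\<in>verts G. if u = v then ?c v else 0)"
    unfolding graph_div_def Poly_Mapping.lookup_sum by (intro sum.cong) auto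
  also have "\<dots> = (if u \<in> verts G then ?c u else 0)"
    by (simp add: sum.delta')
  also have "\<dots> = ?c u"
  proof (cases "u \<in> verts G")
    case False
    then have "{e \<in> arcs G. tail G e = u} = {}" "{e \<in> arcs G. head G e = u} = {}" by auto
    then have "?c u = 0" by (simp only: sum.empty add_0)
    then show ?thesis using False by simp
  qed simp
  finally show ?thesis .
qed

text \<open>The discrete counterpart of \<open>linear_system_nonempty_iff\<close>; with both, the
  two problems become inequalities between coefficients.\<close>

lemma graph_linear_system_nonempty_iff:
  assumes D: "D \<in> divisors (verts G)"
  shows "linear_system (verts G) (graph_equiv G) D \<noteq> {} \<longleftrightarrow>
    (\<exists>f. \<forall>u. 0 \<le> Poly_Mapping.lookup D u + Poly_Mapping.lookup (graph_div G f) u)"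
proof -
  have "u \<in> verts G" if "u \<in> Poly_Mapping.keys (graph_div G f)" for f u
  proof (rule ccontr)
    assume "u \<notin> verts G"
    then have "{e \<in> arcs G. tail G e = u} = {}" "{e \<in> arcs G. head G e = u} = {}" by auto
    then have "Poly_Mapping.lookup (graph_div G f) u = 0"
      unfolding lookup_graph_div by (simp only: sum.empty add_0)
    then show False using that by (simp add: in_keys_iff)
  qed
  then have "D + graph_div G f \<in> divisors (verts G)" for f
    using D Poly_Mapping.keys_add[of D "graph_div G f"] unfolding divisors_def by blast
  moreover have "E - D = graph_div G f \<longleftrightarrow> E = D + graph_div G f" for E f
    by (auto simp: algebra_simps)
  ultimately have *: "E \<in> linear_system (verts G) (graph_equiv G) D \<longleftrightarrow>
      (\<exists>f. E = D + graph_div G f) \<and> effective E" for E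
    unfolding linear_system_def graph_equiv_def mem_Collect_eq by metis
  have "linear_system (verts G) (graph_equiv G) D \<noteq> {} \<longleftrightarrow> (\<exists>f. effective (D + graph_div G f))"
    unfolding ex_in_conv[symmetric] * by metis
  then show ?thesis
    by (simp add: effective_def Poly_Mapping.lookup_add)
qed

lemma unit_length_linear_system_nonempty_iff:
  assumes D: "D \<in> divisors (verts G)"
  shows "linear_system (mpoints G (\<lambda>_. 1)) (metric_equiv G (\<lambda>_. 1)) (vertex_divisor D) \<noteq> {} \<longleftrightarrow>
    linear_system (verts G) (graph_equiv G) D \<noteq> {}"
proof -
  interpret metric_graph G "\<lambda>_. 1" by unfold_locales simp
  let ?l = "\<lambda>_. 1 :: real"
  let ?D = "vertex_divisor D :: ('a, 'b) mpoint divisor"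
  have "?D \<in> divisors (mpoints G ?l)"
    using D by (rule vertex_divisor_in_divisors)
  then have iff: "linear_system (mpoints G ?l) (metric_equiv G ?l) ?D \<noteq> {} \<longleftrightarrow>
      (\<exists>f. rational_function G ?l f \<and> (\<forall>q. 0 \<le> Poly_Mapping.lookup ?D q + ord_at G ?l f q))"
    by (simp add: linear_system_nonempty_iff)
  show ?thesis
    unfolding iff graph_linear_system_nonempty_iff[OF D]
  proof
    assume "\<exists>f. rational_function G ?l f \<and> (\<forall>q. 0 \<le> Poly_Mapping.lookup ?D q + ord_at G ?l f q)"
    then obtain f where f: "rational_function G ?l f"
      and pos: "\<And>q. 0 \<le> Poly_Mapping.lookup ?D q + ord_at G ?l f q"
      by blast
    let ?s = "\<lambda>e. slope (f \<circ> edge_point G ?l e)"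
    have pl: "piecewise_linear_int 1 (f \<circ> edge_point G ?l e)" if "e \<in> arcs G" for e
      using f that by (simp add: rational_function_def)
    have kinks: "0 \<le> ?s e t 1 + ?s e t (-1)" if "e \<in> arcs G" "0 < t" "t < 1" for e t
      using pos[of "Inner e t"] by (simp add: lookup_vertex_divisor ord_at_Inner[OF that])
    \<comment> \<open>The sign reconciles the conventions: \<open>graph_div\<close> sums decreases
      along edges, whereas \<open>ord_at\<close> sums outgoing slopes, which measure
      increase.\<close>
    define g where "g u = - \<lfloor>f (Vertex u)\<rfloor>" for u
    \<comment> \<open>Rounding down is monotone and commutes with adding an integer, so integer
      slope bounds survive it.\<close>
    have floor_diff: "n \<le> \<lfloor>b\<rfloor> - \<lfloor>a\<rfloor>" if "a + of_int n \<le> b" for a b :: real and n :: int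
      using that by linarith
    have tail_bound: "?s e 0 1 \<le> g (tail G e) - g (head G e)" if "e \<in> arcs G" for e
      using convex_endpoint_bound[OF pl[OF that] _ kinks[OF that]]
        floor_diff[of "f (Vertex (tail G e))" "?s e 0 1" "f (Vertex (head G e))"]
      by (simp add: edge_point_def g_def)
    have head_bound: "?s e 1 (-1) \<le> g (head G e) - g (tail G e)" if "e \<in> arcs G" for e
      using convex_endpoint_bound'[OF pl[OF that] _ kinks[OF that]]
        floor_diff[of "f (Vertex (head G e))" "?s e 1 (-1)" "f (Vertex (tail G e))"]
      by (simp add: edge_point_def g_def)
    have "ord_at G ?l f (Vertex u) \<le> Poly_Mapping.lookup (graph_div G g) u" for u
      unfolding ord_at_Vertex lookup_graph_div
      by (intro add_mono sum_mono) (use tail_bound head_bound in auto)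
    then have "0 \<le> Poly_Mapping.lookup D u + Poly_Mapping.lookup (graph_div G g) u" for u
      using pos[of "Vertex u"] by (simp add: lookup_vertex_divisor) (meson add_left_mono order_trans)
    then show "\<exists>f. \<forall>u. 0 \<le> Poly_Mapping.lookup D u + Poly_Mapping.lookup (graph_div G f) u"
      by blast
  next
    assume "\<exists>f. \<forall>u. 0 \<le> Poly_Mapping.lookup D u + Poly_Mapping.lookup (graph_div G f) u"
    then obtain g where g: "\<And>u. 0 \<le> Poly_Mapping.lookup D u + Poly_Mapping.lookup (graph_div G g) u"
      by blast
    \<comment> \<open>Linear interpolation of \<open>- g\<close>, the sign again coming from the two
      conventions; slopes are integers because edges have length one.\<close>
    define f :: "('a, 'b) mpoint \<Rightarrow> real" where
      "f q = (case q of Vertex u \<Rightarrow> - of_int (g u)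
        | Inner e t \<Rightarrow> of_int (g (tail G e) - g (head G e)) * t - of_int (g (tail G e)))" for q
    have f_edge: "(f \<circ> edge_point G ?l e) t =
        of_int (g (tail G e) - g (head G e)) * t + - of_int (g (tail G e))"
      for e t
      by (simp add: f_def edge_point_def)
    have slopes: "0 \<le> t \<Longrightarrow> t < 1 \<Longrightarrow>
          has_slope (f \<circ> edge_point G ?l e) t 1 (g (tail G e) - g (head G e))"
        "0 < t \<Longrightarrow> t \<le> 1 \<Longrightarrow>
          has_slope (f \<circ> edge_point G ?l e) t (-1) (- (g (tail G e) - g (head G e)))" for e t
      using linear_has_slope[of 0 1, OF f_edge] by blast+
    have f: "rational_function G ?l f"
      unfolding rational_function_iff locally_linear_def
    proof (intro ballI allI impI)
      fix e t d assume "inward 1 t d"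
      then show "\<exists>n. has_slope (f \<circ> edge_point G ?l e) t d n"
        unfolding inward_def using slopes by blast
    qed
    have "0 \<le> Poly_Mapping.lookup ?D q + ord_at G ?l f q" for q
    proof (cases q rule: mpoints_cases)
      case (Vertex u)
      have "ord_at G ?l f q = Poly_Mapping.lookup (graph_div G g) u"
        unfolding Vertex ord_at_Vertex lookup_graph_div
        by (intro arg_cong2[of _ _ _ _ "(+)"] sum.cong) (auto simp: slope_eq[OF slopes(1)] slope_eq[OF slopes(2)])
      then show ?thesis
        using g[of u] Vertex by (simp add: lookup_vertex_divisor)
    next
      \<comment> \<open>The two slopes at an inner point are opposite, so no chip appears inside an
        edge.\<close>
      case (Inner e t)
      then show ?thesis
        by (simp add: lookup_vertex_divisor ord_at_Inner slope_eq[OF slopes(1)] slope_eq[OF slopes(2)])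
    next
      case outside
      then have "q \<notin> Poly_Mapping.keys ?D"
        using \<open>?D \<in> divisors (mpoints G ?l)\<close> by (auto simp: divisors_def)
      then show ?thesis
        using outside by (simp add: ord_at_outside in_keys_iff)
    qed
    then show "\<exists>f. rational_function G ?l f \<and> (\<forall>q. 0 \<le> Poly_Mapping.lookup ?D q + ord_at G ?l f q)"
      using f by blast
  qed
qed

end

theorem theorem1p3:
  fixes G :: "('a, 'b) pre_digraph" and D :: "'a divisor"
  assumes "fin_digraph G" and "loopfree_digraph G" and "Digraph_Component.connected G"
    and "D \<in> divisors (verts G)"
  shows "graph_rank G D = metric_rank G (\<lambda>_. 1) (vertex_divisor D)"
proof -
  interpret fin_digraph G by fact
  interpret metric_graph G "\<lambda>_. 1" by unfold_locales simp
  have no_loops: "tail G e \<noteq> head G e" if "e \<in> arcs G" for e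
    using loopfree_digraph.no_loops[OF assms(2) that] .
  let ?P = "mpoints G (\<lambda>_. 1)" and ?R = "metric_equiv G (\<lambda>_. 1)"
  let ?D = "vertex_divisor D :: ('a, 'b) mpoint divisor"
  have empty_iff: "linear_system ?P ?R (?D - vertex_divisor E) = {} \<longleftrightarrow>
      linear_system (verts G) (graph_equiv G) (D - E) = {}" if "E \<in> divisors (verts G)" for E
  proof -
    have "D - E \<in> divisors (verts G)"
      using assms(4) that keys_diff[of D E] unfolding divisors_def by blast
    from unit_length_linear_system_nonempty_iff[OF this] show ?thesis
      by (simp add: vertex_divisor_diff)
  qed
  \<comment> \<open>Both ranks are the \<open>LEAST\<close> of a predicate on \<open>k\<close>, so
    equivalence of the predicates suffices, with no appeal to attainment of the minimum.\<close>
  have "(\<exists>E\<in>divisors (verts G). effective E \<and>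
        linear_system (verts G) (graph_equiv G) (D - E) = {} \<and> k = deg E) \<longleftrightarrow>
      (\<exists>E\<in>divisors ?P. effective E \<and> linear_system ?P ?R (?D - E) = {} \<and> k = deg E)" for k
  proof
    assume "\<exists>E\<in>divisors (verts G). effective E \<and>
        linear_system (verts G) (graph_equiv G) (D - E) = {} \<and> k = deg E"
    then obtain E where "E \<in> divisors (verts G)" "effective E" "k = deg E"
      "linear_system (verts G) (graph_equiv G) (D - E) = {}"
      by blast
    then show "\<exists>E\<in>divisors ?P. effective E \<and> linear_system ?P ?R (?D - E) = {} \<and> k = deg E"
      by (intro bexI[of _ "vertex_divisor E"])
        (simp_all add: empty_iff effective_vertex_divisor deg_vertex_divisor vertex_divisor_in_divisors)
  next
    assume "\<exists>E\<in>divisors ?P. effective E \<and> linear_system ?P ?R (?D - E) = {} \<and> k = deg E"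
    then show "\<exists>E\<in>divisors (verts G). effective E \<and>
        linear_system (verts G) (graph_equiv G) (D - E) = {} \<and> k = deg E"
      using move_divisor_to_vertices[OF no_loops] empty_iff by metis
  qed
  then show ?thesis
    by (simp add: graph_rank_def metric_rank_def divisor_rank_def)
qed

end
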